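(* Let $G$ be a finite group such that $\alpha(\Gamma(G))\leq 6$, where $\Gamma(G)$ is the comaximal subgroup graph of $G$ and $\alpha$ denotes the independence number. Then either $G$ is nilpotent or $G$ is isomorphic to one of the following groups: $S_3$, $D_5$, $\mathbb{Z}_3\rtimes \mathbb{Z}_4$, $\mathbb{Z}_3\rtimes \mathbb{Z}_8$, $\mathbb{Z}_5\rtimes \mathbb{Z}_4$.
   Context: For a group $G$, the comaximal subgroup graph $\Gamma(G)$ is the simple undirected graph whose vertices are the non-trivial proper subgroups of $G$ (all subgroups $H$ with $H\neq\{e\}$ and $H\neq G$), where two distinct vertices $H$ and $K$ are adjacent if and only if $HK=G$, with $HK=\{hk: h\in H, k\in K\}$. The independence number $\alpha(\Gamma)$ of a finite graph $\Gamma$ is the maximum cardinality of a set of pairwise non-adjacent vertices (it is $0$ if the graph has no vertices). $\mathbb{Z}_n$ is the cyclic group of order $n$, $S_3$ is the symmetric group on $3$ letters, and $D_5$ is the dihedral group of order $10$. In each of the semidirect products $\mathbb{Z}_3\rtimes \mathbb{Z}_4$ (order $12$), $\mathbb{Z}_3\rtimes \mathbb{Z}_8$ (order $24$) and $\mathbb{Z}_5\rtimes \mathbb{Z}_4$ (order $20$), a generator of the right-hand cyclic factor acts on the normal factor by inversion $x\mapsto x^{-1}$. *)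

theory Defs
  imports "HOL-Algebra.Algebra"
begin

section \<open>Finite simple graphs and the independence number\<close>

text \<open>A simple undirected graph is a pair of a vertex set and a set of two-element edges.\<close>

type_synonym 'v sgraph = "'v set \<times> 'v set set"

definition independent_set :: "'v sgraph \<Rightarrow> 'v set \<Rightarrow> bool" where
  "independent_set \<Gamma> S \<longleftrightarrow>
     S \<subseteq> fst \<Gamma> \<and> (\<forall>u\<in>S. \<forall>v\<in>S. u \<noteq> v \<longrightarrow> {u, v} \<notin> snd \<Gamma>)"

text \<open>Meaningful for graphs with finitely many vertices only; the empty set is always
  independent, so the value is 0 for the graph without vertices.\<close>

definition independence_number :: "'v sgraph \<Rightarrow> nat" where
  "independence_number \<Gamma> = Max {card S | S. independent_set \<Gamma> S}"

lemma independence_number_no_vertices: "independence_number ({}, E) = 0"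
  by (simp add: independence_number_def independent_set_def)

lemma independence_number_le_iff:
  assumes "finite (fst \<Gamma>)"
  shows "independence_number \<Gamma> \<le> k \<longleftrightarrow> (\<forall>S. independent_set \<Gamma> S \<longrightarrow> card S \<le> k)"
proof -
  have "{S. independent_set \<Gamma> S} \<subseteq> Pow (fst \<Gamma>)"
    by (auto simp: independent_set_def)
  then have "finite {S. independent_set \<Gamma> S}"
    using assms by (meson finite_Pow_iff finite_subset)
  then have "finite (card ` {S. independent_set \<Gamma> S})"
    by (rule finite_imageI)
  moreover have "{card S | S. independent_set \<Gamma> S} = card ` {S. independent_set \<Gamma> S}"
    by auto
  moreover have "independent_set \<Gamma> {}"
    by (simp add: independent_set_def)
  ultimately show ?thesis
    unfolding independence_number_def by (subst Max_le_iff) auto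
qed


section \<open>The comaximal subgroup graph\<close>

definition nontrivial_proper_subgroups :: "('a, 'b) monoid_scheme \<Rightarrow> 'a set set" where
  "nontrivial_proper_subgroups G =
     {H. subgroup H G \<and> H \<noteq> {\<one>\<^bsub>G\<^esub>} \<and> H \<noteq> carrier G}"

definition comaximal_subgroup_graph :: "('a, 'b) monoid_scheme \<Rightarrow> 'a set sgraph" where
  "comaximal_subgroup_graph G =
     (nontrivial_proper_subgroups G,
      {{H, K} | H K. H \<in> nontrivial_proper_subgroups G \<and> K \<in> nontrivial_proper_subgroups G
                   \<and> H \<noteq> K \<and> H <#>\<^bsub>G\<^esub> K = carrier G})"

lemma (in group) set_mult_eq_carrier_commute:
  assumes H: "subgroup H G" and K: "subgroup K G" and HK: "H <#> K = carrier G"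
  shows "K <#> H = carrier G"
proof
  show "K <#> H \<subseteq> carrier G"
    using H K by (simp add: setmult_subset_G subgroup.subset)
  show "carrier G \<subseteq> K <#> H"
  proof
    fix x assume x: "x \<in> carrier G"
    then have "inv x \<in> H <#> K"
      using HK by simp
    then obtain h k where hk: "h \<in> H" "k \<in> K" "inv x = h \<otimes> k"
      by (auto simp: set_mult_def)
    have "h \<in> carrier G" "k \<in> carrier G"
      using hk H K by (auto dest: subgroup.mem_carrier)
    then have "x = inv k \<otimes> inv h"
      using hk(3) x by (metis inv_inv inv_mult_group)
    moreover have "inv k \<in> K" "inv h \<in> H"
      using hk H K by (auto intro: subgroup.m_inv_closed)
    ultimately show "x \<in> K <#> H"
      by (auto simp: set_mult_def)
  qed
qed

lemma (in group) comaximal_subgroup_graph_adjacent_iff: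
  assumes "H \<in> nontrivial_proper_subgroups G" "K \<in> nontrivial_proper_subgroups G" "H \<noteq> K"
  shows "{H, K} \<in> snd (comaximal_subgroup_graph G) \<longleftrightarrow> H <#> K = carrier G"
proof -
  have "K <#> H = carrier G \<longleftrightarrow> H <#> K = carrier G"
    using assms set_mult_eq_carrier_commute unfolding nontrivial_proper_subgroups_def by blast
  then show ?thesis
    using assms by (auto simp: comaximal_subgroup_graph_def doubleton_eq_iff)
qed


section \<open>Nilpotent groups\<close>

definition commutator_subgroup :: "('a, 'b) monoid_scheme \<Rightarrow> 'a set \<Rightarrow> 'a set \<Rightarrow> 'a set" where
  "commutator_subgroup G H K =
     generate G (\<Union>h\<in>H. \<Union>k\<in>K. {h \<otimes>\<^bsub>G\<^esub> k \<otimes>\<^bsub>G\<^esub> inv\<^bsub>G\<^esub> h \<otimes>\<^bsub>G\<^esub> inv\<^bsub>G\<^esub> k})"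

primrec lower_central_series :: "('a, 'b) monoid_scheme \<Rightarrow> nat \<Rightarrow> 'a set" where
  "lower_central_series G 0 = carrier G"
| "lower_central_series G (Suc i) =
     commutator_subgroup G (lower_central_series G i) (carrier G)"

definition nilpotent_group :: "('a, 'b) monoid_scheme \<Rightarrow> bool" where
  "nilpotent_group G \<longleftrightarrow> group G \<and> (\<exists>n. lower_central_series G n = {\<one>\<^bsub>G\<^esub>})"


section \<open>Semidirect products\<close>

text \<open>The outer semidirect product of \<open>N\<close> by \<open>H\<close> with respect to an action \<open>\<phi>\<close> of \<open>H\<close> on \<open>N\<close>
  by automorphisms; it is not a group if \<open>\<phi>\<close> is not such an action.\<close>

definition semidirect_product ::
  "('a, 'c) monoid_scheme \<Rightarrow> ('b, 'd) monoid_scheme \<Rightarrow> ('b \<Rightarrow> 'a \<Rightarrow> 'a) \<Rightarrow> ('a \<times> 'b) monoid" where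
  "semidirect_product N H \<phi> =
     \<lparr>carrier = carrier N \<times> carrier H,
      monoid.mult = (\<lambda>(a, h) (b, k). (a \<otimes>\<^bsub>N\<^esub> \<phi> h b, h \<otimes>\<^bsub>H\<^esub> k)),
      one = (\<one>\<^bsub>N\<^esub>, \<one>\<^bsub>H\<^esub>)\<rparr>"

lemma group_semidirect_product:
  assumes "group N" "group H"
    and closed: "\<And>h a. h \<in> carrier H \<Longrightarrow> a \<in> carrier N \<Longrightarrow> \<phi> h a \<in> carrier N"
    and mult: "\<And>h a b. h \<in> carrier H \<Longrightarrow> a \<in> carrier N \<Longrightarrow> b \<in> carrier N \<Longrightarrow>
      \<phi> h (a \<otimes>\<^bsub>N\<^esub> b) = \<phi> h a \<otimes>\<^bsub>N\<^esub> \<phi> h b"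
    and one: "\<And>a. a \<in> carrier N \<Longrightarrow> \<phi> \<one>\<^bsub>H\<^esub> a = a"
    and comp: "\<And>h a k. h \<in> carrier H \<Longrightarrow> a \<in> carrier N \<Longrightarrow> k \<in> carrier H \<Longrightarrow>
      \<phi> (h \<otimes>\<^bsub>H\<^esub> k) a = \<phi> h (\<phi> k a)"
  shows "group (semidirect_product N H \<phi>)"
proof -
  interpret N: group N by fact
  interpret H: group H by fact
  show ?thesis
  proof (rule groupI)
    fix x assume "x \<in> carrier (semidirect_product N H \<phi>)"
    then obtain a h where x: "x = (a, h)" "a \<in> carrier N" "h \<in> carrier H"
      by (auto simp: semidirect_product_def)
    then show "\<exists>y\<in>carrier (semidirect_product N H \<phi>).
        y \<otimes>\<^bsub>semidirect_product N H \<phi>\<^esub> x = \<one>\<^bsub>semidirect_product N H \<phi>\<^esub>"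
      by (intro bexI[of _ "(inv\<^bsub>N\<^esub> (\<phi> (inv\<^bsub>H\<^esub> h) a), inv\<^bsub>H\<^esub> h)"])
        (simp_all add: semidirect_product_def closed)
  qed (auto simp: semidirect_product_def closed mult one comp N.m_assoc H.m_assoc)
qed

text \<open>\<open>\<int>\<^sub>m \<rtimes> \<int>\<^sub>n\<close>, where the generator 1 of \<open>\<int>\<^sub>n\<close> acts on \<open>\<int>\<^sub>m\<close> by inversion, and hence \<open>k\<close> acts
  by the \<open>k\<close>-th iterate of inversion. This action is well defined on \<open>\<int>\<^sub>n\<close> for even \<open>n > 0\<close>.\<close>

definition inversion_semidirect :: "nat \<Rightarrow> nat \<Rightarrow> (int \<times> int) monoid" where
  "inversion_semidirect m n =
     semidirect_product (integer_mod_group m) (integer_mod_group n)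
       (\<lambda>k. (\<lambda>x. inv\<^bsub>integer_mod_group m\<^esub> x) ^^ nat k)"

text \<open>The dihedral group of order \<open>2n\<close>: rotations \<open>\<int>\<^sub>n\<close>, inverted by a reflection.\<close>

definition dihedral_group :: "nat \<Rightarrow> (int \<times> int) monoid" where
  "dihedral_group n = inversion_semidirect n 2"

lemma order_inversion_semidirect:
  assumes "m > 0" "n > 0"
  shows "order (inversion_semidirect m n) = m * n"
  using assms
  by (simp add: order_def inversion_semidirect_def semidirect_product_def
      carrier_integer_mod_group card_cartesian_product)

lemma (in group) funpow_inv:
  assumes "a \<in> carrier G"
  shows "((\<lambda>x. inv x) ^^ j) a = (if even j then a else inv a)"
  using assms by (induction j) auto

lemma group_inversion_semidirect:
  assumes "m > 0" "n > 0" "even n"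
  shows "group (inversion_semidirect m n)"
  unfolding inversion_semidirect_def
proof (rule group_semidirect_product)
  interpret N: comm_group "integer_mod_group m" by simp
  let ?\<phi> = "\<lambda>k. (\<lambda>x. inv\<^bsub>integer_mod_group m\<^esub> x) ^^ nat k"
  have \<phi>: "?\<phi> h a = (if even h then a else inv\<^bsub>integer_mod_group m\<^esub> a)"
    if "a \<in> carrier (integer_mod_group m)" "h \<in> carrier (integer_mod_group n)" for h a
  proof -
    have "h \<ge> 0"
      using that assms by (auto simp: carrier_integer_mod_group)
    then show ?thesis
      using N.funpow_inv[OF that(1), of "nat h"] by (simp only: even_nat_iff)
  qed
  show "group (integer_mod_group m)" "group (integer_mod_group n)"
    by simp_all
  show "?\<phi> \<one>\<^bsub>integer_mod_group n\<^esub> a = a" for a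
    by simp
  fix h a
  assume h: "h \<in> carrier (integer_mod_group n)" and a: "a \<in> carrier (integer_mod_group m)"
  show closed: "?\<phi> h a \<in> carrier (integer_mod_group m)"
    unfolding \<phi>[OF a h] using N.inv_closed[OF a] a by presburger
  show "?\<phi> h (a \<otimes>\<^bsub>integer_mod_group m\<^esub> b) = ?\<phi> h a \<otimes>\<^bsub>integer_mod_group m\<^esub> ?\<phi> h b"
    if b: "b \<in> carrier (integer_mod_group m)" for b
    unfolding \<phi>[OF a h] \<phi>[OF b h] \<phi>[OF N.m_closed[OF a b] h]
    using N.inv_mult[OF a b] by presburger
  fix k
  assume k: "k \<in> carrier (integer_mod_group n)"
  have par: "even (h \<otimes>\<^bsub>integer_mod_group n\<^esub> k) \<longleftrightarrow> (even h \<longleftrightarrow> even k)"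
    using assms(3) by (simp add: dvd_mod_iff)
  have hk: "h \<otimes>\<^bsub>integer_mod_group n\<^esub> k \<in> carrier (integer_mod_group n)"
    using h k by (rule group.is_monoid[THEN monoid.m_closed, OF group_integer_mod_group])
  show "?\<phi> (h \<otimes>\<^bsub>integer_mod_group n\<^esub> k) a = ?\<phi> h (?\<phi> k a)"
    unfolding \<phi>[OF a hk] par \<phi>[OF a k]
    using \<phi>[OF a h] \<phi>[OF N.inv_closed[OF a] h] N.inv_inv[OF a] by presburger
qed

end

theory Submission
  imports Defs
begin

text \<open>Subgroups that lie in conjugates of one proper subgroup \<open>M\<close> are pairwise non-adjacent: if the
product of \<open>g M g\<inverse>\<close> and \<open>h M h\<inverse>\<close> is \<open>G\<close>, then it contains \<open>g h\<inverse>\<close>, which forces \<open>g\<inverse> h \<in> M\<close>, so the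
two conjugates coincide and \<open>M = G\<close>. Hence the conjugates of \<open>M\<close> have, all together, at most six
nontrivial subgroups (\<open>card_subgroups_below_conjugates\<close>). Almost everything below is a
search for seven such subgroups.

Suppose that \<open>G\<close> is not nilpotent. Then some Sylow \<open>p\<close>-subgroup \<open>P\<close> is not normal
(\<open>nilpotent_of_normal_sylow\<close>). Its number \<open>n\<close> of conjugates satisfies \<open>3 \<le> n \<le> 6\<close> and is 1
modulo \<open>p\<close>. If the normalizer \<open>N\<close> of \<open>P\<close> were larger than \<open>P\<close>, then \<open>n\<close> conjugates of \<open>P\<close>, \<open>n\<close>
conjugates of \<open>N\<close> and a subgroup of \<open>N\<close> of prime order different from \<open>p\<close> would be too many. So
\<open>N = P\<close> and \<open>G\<close> has order \<open>n \<cdot> |P|\<close> (\<open>non_normal_sylow\<close>). For odd \<open>p\<close> the number \<open>n\<close> is 4 or 6,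
and \<open>P\<close> moves a subgroup of order 2 through at least three conjugates; these and the conjugates
of \<open>P\<close> are again too many (\<open>odd_sylow_normal\<close>). Hence \<open>p = 2\<close>, \<open>n\<close> is 3 or 5, and the Sylow
\<open>n\<close>-subgroup \<open>Q\<close>, of order \<open>n\<close>, is normal.

A subgroup of \<open>P\<close> that does not centralize \<open>Q\<close> has \<open>n\<close> conjugates under \<open>Q\<close>. Counting shows that
no proper subgroup of \<open>P\<close> is of this kind (\<open>commute_of_mem_proper_subgroup\<close>). Therefore any \<open>x\<close> in
\<open>P\<close> that does not centralize \<open>Q\<close> generates \<open>P\<close>, its square centralizes \<open>Q\<close>, and \<open>x\<close> acts on \<open>Q\<close>
as an automorphism of order 2 of a group of prime order, which is inversion. So \<open>G\<close> is
\<open>\<int>\<^sub>n \<rtimes> \<int>\<^sub>m\<close> with \<open>m = 2\<^sup>k\<close>, and two more counts give \<open>k \<le> 3\<close> for \<open>n = 3\<close> and \<open>k \<le> 2\<close> for \<open>n = 5\<close>.\<close>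

text \<open>From here on \<open>prime\<close> is primality of numbers, not that of elements of a monoid.\<close>

hide_const (open) Divisibility.prime


section \<open>Conjugate subsets\<close>

context group
begin

definition conjugate :: "'a \<Rightarrow> 'a set \<Rightarrow> 'a set" where
  "conjugate g A = (\<lambda>x. g \<otimes> x \<otimes> inv g) ` A"

lemma conjugate_eq_cosets: "conjugate g A = g <# A #> inv g"
  by (auto simp: conjugate_def l_coset_def r_coset_def)

lemma inj_on_conjugation: "g \<in> carrier G \<Longrightarrow> inj_on (\<lambda>x. g \<otimes> x \<otimes> inv g) (carrier G)"
  by (auto simp: inj_on_def)

lemma card_conjugate: "g \<in> carrier G \<Longrightarrow> A \<subseteq> carrier G \<Longrightarrow> card (conjugate g A) = card A"
  unfolding conjugate_def by (intro card_image inj_on_subset[OF inj_on_conjugation])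

lemma conjugate_subset: "g \<in> carrier G \<Longrightarrow> A \<subseteq> carrier G \<Longrightarrow> conjugate g A \<subseteq> carrier G"
  by (auto simp: conjugate_def)

lemma conjugate_mono: "A \<subseteq> B \<Longrightarrow> conjugate g A \<subseteq> conjugate g B"
  by (auto simp: conjugate_def)

lemma conjugate_one: "A \<subseteq> carrier G \<Longrightarrow> conjugate \<one> A = A"
  by (force simp: conjugate_def)

lemma conjugate_conjugate:
  "g \<in> carrier G \<Longrightarrow> h \<in> carrier G \<Longrightarrow> A \<subseteq> carrier G \<Longrightarrow>
    conjugate g (conjugate h A) = conjugate (g \<otimes> h) A"
  unfolding conjugate_def image_image
  by (intro image_cong refl) (auto simp: inv_mult_group m_assoc)

lemma conjugate_inv_cancel:
  "g \<in> carrier G \<Longrightarrow> A \<subseteq> carrier G \<Longrightarrow> conjugate (inv g) (conjugate g A) = A"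
  by (simp add: conjugate_conjugate conjugate_one)

text \<open>Comparing two conjugates amounts to asking whether one element normalizes the set; this is how
normalizers enter the counts of conjugates.\<close>

lemma conjugate_eq_iff:
  "g \<in> carrier G \<Longrightarrow> h \<in> carrier G \<Longrightarrow> A \<subseteq> carrier G \<Longrightarrow> 
    conjugate g A = conjugate h A \<longleftrightarrow> conjugate (inv h \<otimes> g) A = A"
proof
  assume g: "g \<in> carrier G" and h: "h \<in> carrier G" and A: "A \<subseteq> carrier G"
  have *: "conjugate (inv h \<otimes> g) A = conjugate (inv h) (conjugate g A)"
    using g h A by (simp add: conjugate_conjugate)
  { assume "conjugate g A = conjugate h A"
    then show "conjugate (inv h \<otimes> g) A = A"
      unfolding * using h A by (simp add: conjugate_inv_cancel) }
  assume "conjugate (inv h \<otimes> g) A = A"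
  then have "conjugate h A = conjugate h (conjugate (inv h) (conjugate g A))" unfolding * by simp
  also have "\<dots> = conjugate g A"
    using g h A by (simp add: conjugate_conjugate conjugate_subset m_assoc[symmetric])
  finally show "conjugate g A = conjugate h A" by simp
qed

lemma subgroup_conjugate: "g \<in> carrier G \<Longrightarrow> subgroup H G \<Longrightarrow> subgroup (conjugate g H) G"
  by (simp add: conjugate_eq_cosets subgroup_conjugation_is_surj2)

lemma normal_iff_conjugate:
  "subgroup N G \<Longrightarrow> N \<lhd> G \<longleftrightarrow> (\<forall>g\<in>carrier G. conjugate g N = N)"
proof safe
  fix g x assume N: "subgroup N G" "N \<lhd> G" and g: "g \<in> carrier G"
  { show "x \<in> conjugate g N \<Longrightarrow> x \<in> N"
      using N g by (auto simp: conjugate_def normal_inv_iff) }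
  assume x: "x \<in> N"
  then have xc: "x \<in> carrier G" using N by (meson subgroup.mem_carrier)
  have "inv g \<otimes> x \<otimes> g \<in> N" using N g x by (metis normal_inv_iff inv_closed inv_inv)
  moreover have "x = g \<otimes> (inv g \<otimes> x \<otimes> g) \<otimes> inv g"
    using xc g by (simp add: conjugation_is_surj)
  ultimately show "x \<in> conjugate g N" by (auto simp: conjugate_def)
next
  assume "subgroup N G" "\<forall>g\<in>carrier G. conjugate g N = N"
  then show "N \<lhd> G" by (auto simp: normal_inv_iff conjugate_def)
qed

lemma normalizer_eq:
  "A \<subseteq> carrier G \<Longrightarrow> normalizer G A = {g \<in> carrier G. conjugate g A = A}"
  by (auto simp: normalizer_def stabilizer_def conjugate_eq_cosets)

lemma card_subgroup_dvd:
  assumes "subgroup H G" "subgroup K G" "H \<subseteq> K"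
  shows "card H dvd card K"
proof -
  interpret K: group "G\<lparr>carrier := K\<rparr>" using assms by (simp add: subgroup_imp_group)
  have "subgroup H (G\<lparr>carrier := K\<rparr>)" using assms by (simp add: subgroup_incl)
  from K.lagrange[OF this] have "card (rcosets\<^bsub>G\<lparr>carrier := K\<rparr>\<^esub> H) * card H = card K"
    by (simp add: order_def)
  then show ?thesis by (metis dvd_triv_right)
qed

text \<open>The orbit-stabilizer theorem for the action of \<open>K\<close> on subsets of \<open>G\<close> by conjugation.\<close>

lemma conjugates_orbit_stabilizer:
  assumes "subgroup K G" "A \<subseteq> carrier G"
  shows "card ((\<lambda>g. conjugate g A) ` K) * card {g \<in> K. conjugate g A = A} = card K"
proof -
  let ?\<phi> = "\<lambda>g. \<lambda>H\<in>{H. H \<subseteq> carrier G}. g <# H #> inv g"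
  interpret group_action "G\<lparr>carrier := K\<rparr>" "{H. H \<subseteq> carrier G}" ?\<phi>
    by (rule group_action.induced_action[OF action_by_conjugation_on_power_set assms(1)])
  have "orbit (G\<lparr>carrier := K\<rparr>) ?\<phi> A = (\<lambda>g. conjugate g A) ` K"
    "stabilizer (G\<lparr>carrier := K\<rparr>) ?\<phi> A = {g \<in> K. conjugate g A = A}"
    using assms(2) by (auto simp: orbit_def stabilizer_def conjugate_eq_cosets)
  then show ?thesis
    using orbit_stabilizer_theorem[of A] assms(2) by (simp add: order_def)
qed

lemma conjugates_by_subgroup_eq:
  assumes K: "subgroup K G" and A: "A \<subseteq> carrier G" and k: "k \<in> K"
  shows "(\<lambda>g. conjugate g (conjugate k A)) ` K = (\<lambda>g. conjugate g A) ` K"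
proof -
  have c: "g \<in> K \<Longrightarrow> g \<in> carrier G" for g using K by (rule subgroup.mem_carrier)
  have "(\<lambda>g. conjugate g (conjugate k A)) ` K = (\<lambda>g. conjugate g A) ` ((\<lambda>g. g \<otimes> k) ` K)"
    unfolding image_image by (intro image_cong refl) (simp add: conjugate_conjugate c k A)
  also have "(\<lambda>g. g \<otimes> k) ` K = K #> k" by (auto simp: r_coset_def)
  also have "\<dots> = K" using K k by (simp add: subgroup.rcos_const)
  finally show ?thesis .
qed

text \<open>The class equation in the form in which it is needed twice, for the conjugates of a Sylow subgroup
and for the cosets of a normal subgroup: the points that a \<open>p\<close>-group moves fall into orbits whose
sizes are powers of \<open>p\<close> greater than 1.\<close>

lemma p_group_moved_points:
  assumes p: "prime p" and K: "subgroup K G" "card K = p ^ a"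
    and E: "finite E" "\<And>A. A \<in> E \<Longrightarrow> A \<subseteq> carrier G"
      "\<And>A g. A \<in> E \<Longrightarrow> g \<in> K \<Longrightarrow> conjugate g A \<in> E"
  shows "p dvd card {A \<in> E. \<exists>g\<in>K. conjugate g A \<noteq> A}"
proof -
  let ?M = "{A \<in> E. \<exists>g\<in>K. conjugate g A \<noteq> A}"
  define orb where "orb A = (\<lambda>g. conjugate g A) ` K" for A
  have c: "g \<in> K \<Longrightarrow> g \<in> carrier G" for g using K(1) by (rule subgroup.mem_carrier)
  have one: "\<one> \<in> K" using K(1) by (rule subgroup.one_closed)
  have self: "A \<in> orb A" if "A \<in> E" for A
    using one E(2)[OF that] unfolding orb_def by (metis conjugate_one imageI)
  have same: "orb B = orb A" if "A \<in> E" "B \<in> orb A" for A B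
  proof -
    from that(2) obtain k where "k \<in> K" "B = conjugate k A" by (auto simp: orb_def)
    then show ?thesis
      unfolding orb_def using conjugates_by_subgroup_eq[OF K(1) E(2)[OF that(1)]] by simp
  qed
  have moved: "B \<in> ?M" if A: "A \<in> ?M" and B: "B \<in> orb A" for A B
  proof -
    have "B \<in> E" using A B E(3) by (auto simp: orb_def)
    moreover have "\<exists>g\<in>K. conjugate g B \<noteq> B"
    proof (rule ccontr)
      assume "\<not> (\<exists>g\<in>K. conjugate g B \<noteq> B)"
      then have "orb B \<subseteq> {B}" by (auto simp: orb_def)
      moreover have "orb B = orb A" using same[OF _ B] A by blast
      moreover have "A \<in> orb A" using self A by blast
      ultimately have "orb A = {A}" by blast
      then show False using A by (auto simp: orb_def)
    qed
    ultimately show ?thesis by simp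
  qed
  have "p dvd card (orb A)" if A: "A \<in> ?M" for A
  proof -
    have "card (orb A) dvd p ^ a"
      unfolding orb_def K(2)[symmetric]
      by (rule dvdI[OF conjugates_orbit_stabilizer[OF K(1) E(2), symmetric]]) (use A in simp)
    then obtain i where i: "card (orb A) = p ^ i" using p by (auto simp: divides_primepow_nat)
    have "card (orb A) \<noteq> 1"
    proof
      assume "card (orb A) = 1"
      then obtain B where "orb A = {B}" by (rule card_1_singletonE)
      moreover have "A \<in> orb A" using self A by simp
      ultimately have "orb A = {A}" by simp
      then show False using A by (auto simp: orb_def)
    qed
    then show ?thesis using i by (cases i) auto
  qed
  note orb_dvd = this
  have union: "\<Union> (orb ` ?M) = ?M"
  proof
    show "\<Union> (orb ` ?M) \<subseteq> ?M" using moved by (intro UN_least subsetI)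
    show "?M \<subseteq> \<Union> (orb ` ?M)" using self by (intro subsetI UN_I) auto
  qed
  have "p dvd card (\<Union> (orb ` ?M))"
  proof (rule dvd_partition)
    show "finite (\<Union> (orb ` ?M))" unfolding union using E(1) by simp
    show "\<forall>c\<in>orb ` ?M. p dvd card c" using orb_dvd by (intro ballI) (elim imageE, simp)
    show "\<forall>c1\<in>orb ` ?M. \<forall>c2\<in>orb ` ?M. c1 \<noteq> c2 \<longrightarrow> c1 \<inter> c2 = {}"
    proof (intro ballI impI)
      fix c1 c2 assume c: "c1 \<in> orb ` ?M" "c2 \<in> orb ` ?M" and ne: "c1 \<noteq> c2"
      then obtain A B where AB: "A \<in> E" "B \<in> E" "c1 = orb A" "c2 = orb B" by blast
      show "c1 \<inter> c2 = {}"
      proof (rule ccontr)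
        assume "c1 \<inter> c2 \<noteq> {}"
        then obtain C where C: "C \<in> orb A" "C \<in> orb B" using AB by blast
        show False
          using same[OF AB(1) C(1)] same[OF AB(2) C(2)] AB(3,4) ne by blast
      qed
    qed
  qed
  then show ?thesis unfolding union .
qed

end

section \<open>Sylow subgroups\<close>

context group
begin

lemma conjugate_self:
  assumes H: "subgroup H G" and x: "x \<in> H"
  shows "conjugate x H = H"
proof -
  have sub: "conjugate y H \<subseteq> H" if "y \<in> H" for y
    using that H by (auto simp: conjugate_def subgroup.m_closed subgroup.m_inv_closed)
  have Hc: "H \<subseteq> carrier G" using H by (rule subgroup.subset)
  have xi: "inv x \<in> H" using H x by (rule subgroup.m_inv_closed)
  have xc: "x \<in> carrier G" "inv x \<in> carrier G" using x xi Hc by auto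
  have "H = conjugate x (conjugate (inv x) H)"
    using xc Hc by (simp add: conjugate_conjugate conjugate_one)
  also have "\<dots> \<subseteq> conjugate x H" by (intro conjugate_mono sub xi)
  finally show ?thesis using sub[OF x] by simp
qed

lemma nat_pow_card_subgroup:
  assumes "subgroup H G" "x \<in> H"
  shows "x [^] card H = \<one>"
proof -
  interpret H: group "G\<lparr>carrier := H\<rparr>" using assms by (simp add: subgroup_imp_group)
  show ?thesis using H.pow_order_eq_1[of x] assms(2) by (simp add: order_def nat_pow_consistent[symmetric])
qed

lemma ord_dvd_card_subgroup:
  "subgroup H G \<Longrightarrow> x \<in> H \<Longrightarrow> ord x dvd card H"
  by (metis nat_pow_card_subgroup pow_eq_id subgroup.mem_carrier)

lemma eq_one_of_coprime_powers:
  assumes "x \<in> carrier G" "x [^] a = \<one>" "x [^] b = \<one>" "coprime a (b::nat)"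
  shows "x = \<one>"
proof -
  have "ord x dvd a" "ord x dvd b" using assms pow_eq_id by auto
  with assms(4) have "ord x = 1" by (metis coprime_common_divisor_nat)
  then show ?thesis using ord_eq_1[OF assms(1)] by simp
qed

lemma eq_one_of_mem_coprime_subgroups:
  assumes "subgroup H G" "subgroup K G" "coprime (card H) (card K)" "x \<in> H" "x \<in> K"
  shows "x = \<one>"
  by (rule eq_one_of_coprime_powers[OF subgroup.mem_carrier[OF assms(1,4)]
      nat_pow_card_subgroup[OF assms(1,4)] nat_pow_card_subgroup[OF assms(2,5)] assms(3)])

definition sylow_subgroup :: "nat \<Rightarrow> 'a set \<Rightarrow> bool" where
  "sylow_subgroup p P \<longleftrightarrow> subgroup P G \<and> card P = p ^ multiplicity p (order G)"

text \<open>Sylow's existence theorem inside a subgroup. It supplies the Sylow subgroups, the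
subgroups of prime order and the subgroups of 2-power order that are counted later.\<close>

lemma ex_subgroup_prime_power_card:
  assumes "prime p" "finite (carrier G)" "subgroup H G" "p ^ a dvd card H"
  shows "\<exists>K. subgroup K G \<and> K \<subseteq> H \<and> card K = p ^ a"
proof -
  have H: "group (G\<lparr>carrier := H\<rparr>)" using assms(3) by (simp add: subgroup_imp_group)
  have fin: "finite H" using assms by (meson finite_subset subgroup.subset)
  from assms(4) obtain m where "card H = p ^ a * m" by (auto simp: dvd_def)
  then have "order (G\<lparr>carrier := H\<rparr>) = p ^ a * m" by (simp add: order_def)
  from sylow_thm[OF assms(1) H this] fin obtain K
    where K: "subgroup K (G\<lparr>carrier := H\<rparr>)" "card K = p ^ a" by auto
  then show ?thesis
    using incl_subgroup[OF assms(3)] subgroup.subset[OF K(1)] by auto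
qed

lemma ex_sylow_subgroup:
  assumes "prime p" "finite (carrier G)"
  shows "\<exists>P. sylow_subgroup p P"
  using ex_subgroup_prime_power_card[OF assms subgroup_self, of "multiplicity p (order G)"]
  by (auto simp: sylow_subgroup_def order_def multiplicity_dvd)

lemma order_eq_sylow_times:
  assumes p: "prime p" and fin: "finite (carrier G)" and P: "sylow_subgroup p P"
  obtains m where "order G = card P * m" "\<not> p dvd m"
proof -
  have "order G \<noteq> 0" using fin by (simp add: order_gt_0_iff_finite)
  moreover have "\<not> is_unit p" using p by auto
  ultimately obtain m where "order G = p ^ multiplicity p (order G) * m" "\<not> p dvd m"
    by (metis multiplicity_decompose')
  then show thesis using that P by (simp add: sylow_subgroup_def)
qed

text \<open>The image of \<open>x\<close> in the quotient of the normalizer by \<open>P\<close> has \<open>p\<close>-power order, while the order of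
that quotient is prime to \<open>p\<close>. So the image is trivial.\<close>

lemma p_element_normalizing_sylow:
  assumes p: "prime p" and fin: "finite (carrier G)" and P: "sylow_subgroup p P"
    and x: "x \<in> carrier G" "conjugate x P = P" "x [^] (p ^ k) = \<one>"
  shows "x \<in> P"
proof -
  have sP: "subgroup P G" using P by (simp add: sylow_subgroup_def)
  then have Pc: "P \<subseteq> carrier G" by (rule subgroup.subset)
  define N where "N = normalizer G P"
  define N' where "N' = G\<lparr>carrier := N\<rparr>"
  have sN: "subgroup N G" unfolding N_def using Pc by (rule normalizer_imp_subgroup)
  have xN: "x \<in> N" using x Pc by (simp add: N_def normalizer_eq)
  interpret N: group N' unfolding N'_def using sN by (rule subgroup_imp_group)
  interpret P: normal P N' unfolding N'_def N_def using sP by (rule subgroup_in_normalizer)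
  interpret Q: group "N' Mod P" by (rule P.factorgroup_is_group)
  define c where "c = P #>\<^bsub>N'\<^esub> x"
  interpret h: group_hom N' "N' Mod P" "\<lambda>a. P #>\<^bsub>N'\<^esub> a"
    by (simp add: group_hom_def group_hom_axioms_def N.group_axioms Q.group_axioms P.r_coset_hom_Mod)
  have xN': "x \<in> carrier N'" using xN by (simp add: N'_def)
  have cQ: "c \<in> carrier (N' Mod P)" unfolding c_def using xN' by (rule h.hom_closed)
  have "c [^]\<^bsub>N' Mod P\<^esub> (p ^ k) = P #>\<^bsub>N'\<^esub> (x [^]\<^bsub>N'\<^esub> (p ^ k))"
    unfolding c_def using h.hom_nat_pow[OF xN'] by simp
  also have "x [^]\<^bsub>N'\<^esub> (p ^ k) = \<one>\<^bsub>N'\<^esub>"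
    using x(3) by (simp add: N'_def nat_pow_consistent[symmetric])
  also have "P #>\<^bsub>N'\<^esub> \<one>\<^bsub>N'\<^esub> = \<one>\<^bsub>N' Mod P\<^esub>" by (rule h.hom_one)
  finally have pow1: "c [^]\<^bsub>N' Mod P\<^esub> (p ^ k) = \<one>\<^bsub>N' Mod P\<^esub>" .
  have pow2: "c [^]\<^bsub>N' Mod P\<^esub> order (N' Mod P) = \<one>\<^bsub>N' Mod P\<^esub>"
    using cQ by (rule Q.pow_order_eq_1)
  obtain m where m: "order G = card P * m" "\<not> p dvd m"
    using order_eq_sylow_times[OF p fin P] by metis
  have "order (N' Mod P) * card P = card N"
    using N.lagrange[OF P.subgroup_axioms] by (simp add: FactGroup_def order_def N'_def)
  moreover have "card N dvd order G"
    unfolding order_def using sN subgroup_self subgroup.subset[OF sN] by (rule card_subgroup_dvd)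
  ultimately have "order (N' Mod P) * card P dvd m * card P" using m by (simp add: mult.commute)
  moreover have "card P > 0" using P p by (simp add: sylow_subgroup_def prime_gt_0_nat)
  ultimately have "order (N' Mod P) dvd m" by simp
  then have "\<not> p dvd order (N' Mod P)" using m(2) by (meson dvd_trans)
  then have "coprime (p ^ k) (order (N' Mod P))" using p by (simp add: prime_imp_coprime)
  then have "c = \<one>\<^bsub>N' Mod P\<^esub>"
    using Q.eq_one_of_coprime_powers[OF cQ pow1 pow2] by simp
  then have "P #>\<^bsub>N'\<^esub> x = P" by (simp add: c_def FactGroup_def)
  moreover have "x \<in> P #>\<^bsub>N'\<^esub> x" using N.rcos_self[OF xN' P.subgroup_axioms] .
  ultimately show ?thesis by simp
qed

definition conjugates :: "'a set \<Rightarrow> 'a set set" where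
  "conjugates A = (\<lambda>g. conjugate g A) ` carrier G"

lemma conjugates_self: "A \<subseteq> carrier G \<Longrightarrow> A \<in> conjugates A"
  unfolding conjugates_def by (metis conjugate_one image_eqI one_closed)

lemma sylow_subgroup_conjugate:
  "g \<in> carrier G \<Longrightarrow> sylow_subgroup p P \<Longrightarrow> sylow_subgroup p (conjugate g P)"
  by (simp add: sylow_subgroup_def subgroup_conjugate card_conjugate subgroup.subset)

lemma sylow_normalizing_sylow:
  assumes p: "prime p" and fin: "finite (carrier G)"
    and P: "sylow_subgroup p P" and R: "sylow_subgroup p R"
    and norm: "\<And>x. x \<in> R \<Longrightarrow> conjugate x P = P"
  shows "R = P"
proof (rule card_subset_eq)
  have sub: "subgroup P G" "subgroup R G" using P R by (auto simp: sylow_subgroup_def)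
  show "finite P" using fin sub by (meson finite_subset subgroup.subset)
  show "R \<subseteq> P"
  proof
    fix x assume x: "x \<in> R"
    show "x \<in> P"
      using p_element_normalizing_sylow[OF p fin P subgroup.mem_carrier[OF sub(2) x] norm[OF x]]
        nat_pow_card_subgroup[OF sub(2) x] R by (simp add: sylow_subgroup_def)
  qed
  show "card R = card P" using P R by (simp add: sylow_subgroup_def)
qed

text \<open>Under conjugation by \<open>P\<close> the only fixed conjugate is \<open>P\<close> itself, since a fixed one is a Sylow
subgroup that \<open>P\<close> normalizes. The other conjugates are moved points.\<close>

lemma sylow_card_conjugates_mod:
  assumes p: "prime p" and fin: "finite (carrier G)" and P: "sylow_subgroup p P"
  shows "p dvd card (conjugates P) - 1"
proof -
  have sP: "subgroup P G" using P by (simp add: sylow_subgroup_def)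
  then have Pc: "P \<subseteq> carrier G" by (rule subgroup.subset)
  have finC: "finite (conjugates P)" using fin by (simp add: conjugates_def)
  have cP: "x \<in> P \<Longrightarrow> x \<in> carrier G" for x using Pc by auto
  have "{A \<in> conjugates P. \<exists>g\<in>P. conjugate g A \<noteq> A} = conjugates P - {P}"
  proof (intro subset_antisym subsetI)
    fix A assume "A \<in> {A \<in> conjugates P. \<exists>g\<in>P. conjugate g A \<noteq> A}"
    then show "A \<in> conjugates P - {P}" using conjugate_self[OF sP] by blast
  next
    fix A assume A: "A \<in> conjugates P - {P}"
    then obtain g where "g \<in> carrier G" "A = conjugate g P" by (auto simp: conjugates_def)
    then have "sylow_subgroup p A" using P by (simp add: sylow_subgroup_conjugate)
    with A have "\<exists>g\<in>P. conjugate g A \<noteq> A"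
      using sylow_normalizing_sylow[OF p fin _ P] by blast
    with A show "A \<in> {A \<in> conjugates P. \<exists>g\<in>P. conjugate g A \<noteq> A}" by blast
  qed
  moreover have "p dvd card {A \<in> conjugates P. \<exists>g\<in>P. conjugate g A \<noteq> A}"
  proof (rule p_group_moved_points[OF p sP _ finC])
    show "card P = p ^ multiplicity p (order G)" using P by (simp add: sylow_subgroup_def)
    show "A \<subseteq> carrier G" if "A \<in> conjugates P" for A
      using that conjugate_subset[OF _ Pc] by (auto simp: conjugates_def)
    show "conjugate g A \<in> conjugates P" if "A \<in> conjugates P" "g \<in> P" for A g
      using that conjugate_conjugate[OF _ _ Pc] cP by (auto simp: conjugates_def)
  qed
  ultimately show ?thesis using conjugates_self[OF Pc] finC by simp
qed

lemma card_conjugates: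
  assumes "A \<subseteq> carrier G"
  shows "card (conjugates A) * card (normalizer G A) = order G"
  using conjugates_orbit_stabilizer[OF subgroup_self assms]
  by (simp add: conjugates_def normalizer_eq assms order_def)

lemma card_conjugates_eq_1_iff:
  assumes "subgroup H G" "finite (carrier G)"
  shows "card (conjugates H) = 1 \<longleftrightarrow> H \<lhd> G"
proof -
  have Hc: "H \<subseteq> carrier G" using assms(1) by (rule subgroup.subset)
  have "card (conjugates H) = 1 \<longleftrightarrow> conjugates H = {H}"
    using conjugates_self[OF Hc] by (metis card_1_singletonE is_singletonI is_singleton_altdef singletonD)
  also have "\<dots> \<longleftrightarrow> (\<forall>g\<in>carrier G. conjugate g H = H)"
    using conjugates_self[OF Hc] by (auto simp: conjugates_def)
  finally show ?thesis using assms(1) by (simp add: normal_iff_conjugate)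
qed

end

section \<open>Nilpotency from normal Sylow subgroups\<close>

context group
begin

lemma mult_inv_cancel_left:
  "x \<in> carrier G \<Longrightarrow> y \<in> carrier G \<Longrightarrow> inv x \<otimes> (x \<otimes> y) = y"
  "x \<in> carrier G \<Longrightarrow> y \<in> carrier G \<Longrightarrow> x \<otimes> (inv x \<otimes> y) = y"
  by (simp_all add: m_assoc[symmetric])

text \<open>The order of a subgroup that contains a Sylow subgroup for each prime is divisible by every
prime power that divides the order of \<open>G\<close>, hence by that order itself.\<close>

lemma eq_carrier_of_sylow_subgroups:
  assumes fin: "finite (carrier G)" and H: "subgroup H G"
    and sylow: "\<And>p. prime p \<Longrightarrow> \<exists>P. sylow_subgroup p P \<and> P \<subseteq> H"
  shows "H = carrier G"
proof -
  have pos: "order G \<noteq> 0" using fin by (simp add: order_gt_0_iff_finite)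
  have "order G dvd card H"
  proof (rule multiplicity_le_imp_dvd[OF pos])
    fix p :: nat assume p: "prime p"
    obtain P where P: "sylow_subgroup p P" "P \<subseteq> H" using sylow[OF p] by blast
    have "p ^ multiplicity p (order G) dvd card H"
      using card_subgroup_dvd[of P H] P H by (simp add: sylow_subgroup_def)
    moreover have "card H \<noteq> 0"
      using H fin by (simp add: subgroup.finite_imp_card_positive)
    ultimately show "multiplicity p (order G) \<le> multiplicity p (card H)"
      using p by (intro multiplicity_geI) auto
  qed
  then have "card (carrier G) \<le> card H"
    using H fin by (intro dvd_imp_le) (auto simp: order_def subgroup.finite_imp_card_positive)
  then show ?thesis by (rule card_seteq[OF fin subgroup.subset[OF H]])
qed

text \<open>For normal \<open>N\<close> this says that the images of \<open>x\<close> and \<open>y\<close> in \<open>G / N\<close> commute. Working with elements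
avoids the quotient group, whose elements have another type.\<close>

definition commute_mod :: "'a set \<Rightarrow> 'a \<Rightarrow> 'a \<Rightarrow> bool" where
  "commute_mod N x y \<longleftrightarrow> x \<otimes> y \<otimes> inv x \<otimes> inv y \<in> N"

lemma commute_mod_sym:
  assumes "N \<lhd> G" "x \<in> carrier G" "y \<in> carrier G" "commute_mod N x y"
  shows "commute_mod N y x"
proof -
  have "inv (x \<otimes> y \<otimes> inv x \<otimes> inv y) \<in> N"
    using assms(4) subgroup.m_inv_closed[OF normal_imp_subgroup[OF assms(1)]]
    unfolding commute_mod_def by blast
  moreover have "inv (x \<otimes> y \<otimes> inv x \<otimes> inv y) = y \<otimes> x \<otimes> inv y \<otimes> inv x"
    using assms(2,3) by (simp add: inv_mult_group m_assoc)
  ultimately show ?thesis by (simp add: commute_mod_def)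
qed

lemma commute_iff_commute_mod:
  assumes "x \<in> carrier G" "y \<in> carrier G"
  shows "commute_mod {\<one>} x y \<longleftrightarrow> x \<otimes> y = y \<otimes> x"
proof -
  have eq: "x \<otimes> y \<otimes> inv x \<otimes> inv y = (x \<otimes> y) \<otimes> inv (y \<otimes> x)"
    using assms by (simp add: inv_mult_group m_assoc)
  show ?thesis
  proof
    assume "commute_mod {\<one>} x y"
    then have "(x \<otimes> y) \<otimes> inv (y \<otimes> x) \<otimes> (y \<otimes> x) = y \<otimes> x"
      using assms by (simp add: commute_mod_def eq)
    moreover have "(x \<otimes> y) \<otimes> inv (y \<otimes> x) \<otimes> (y \<otimes> x) = x \<otimes> y"
      using assms by (simp only: m_assoc m_closed inv_closed l_inv r_one)
    ultimately show "x \<otimes> y = y \<otimes> x" by simp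
  next
    assume "x \<otimes> y = y \<otimes> x"
    then show "commute_mod {\<one>} x y" unfolding commute_mod_def eq using assms by simp
  qed
qed

text \<open>This is the preimage of the centralizer of \<open>N x\<close> in \<open>G / N\<close>. Closure follows from
\<open>[x, g h] = [x, g] \<cdot> g [x, h] g\<inverse>\<close> and \<open>[x, g\<inverse>] = g\<inverse> [x, g]\<inverse> g\<close>.\<close>

lemma subgroup_commute_mod:
  assumes N: "N \<lhd> G" and x: "x \<in> carrier G"
  shows "subgroup {g \<in> carrier G. commute_mod N x g} G"
proof
  interpret N: normal N G by fact
  show "{g \<in> carrier G. commute_mod N x g} \<subseteq> carrier G" by auto
  show "\<one> \<in> {g \<in> carrier G. commute_mod N x g}"
    using x by (simp add: commute_mod_def)
  fix g assume "g \<in> {g \<in> carrier G. commute_mod N x g}"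
  then have g: "g \<in> carrier G" "x \<otimes> g \<otimes> inv x \<otimes> inv g \<in> N" by (auto simp: commute_mod_def)
  have "inv (x \<otimes> g \<otimes> inv x \<otimes> inv g) \<in> N" using g(2) by (rule N.m_inv_closed)
  then have "inv g \<otimes> inv (x \<otimes> g \<otimes> inv x \<otimes> inv g) \<otimes> g \<in> N"
    using N.inv_op_closed1 g(1) by blast
  moreover have "inv g \<otimes> inv (x \<otimes> g \<otimes> inv x \<otimes> inv g) \<otimes> g = x \<otimes> inv g \<otimes> inv x \<otimes> inv (inv g)"
    using g(1) x by (simp add: inv_mult_group m_assoc mult_inv_cancel_left)
  ultimately show "inv g \<in> {g \<in> carrier G. commute_mod N x g}"
    using g(1) by (simp add: commute_mod_def)
  fix h assume "h \<in> {g \<in> carrier G. commute_mod N x g}"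
  then have h: "h \<in> carrier G" "x \<otimes> h \<otimes> inv x \<otimes> inv h \<in> N" by (auto simp: commute_mod_def)
  have "g \<otimes> (x \<otimes> h \<otimes> inv x \<otimes> inv h) \<otimes> inv g \<in> N"
    using N.inv_op_closed2 g(1) h(2) by blast
  then have "(x \<otimes> g \<otimes> inv x \<otimes> inv g) \<otimes> (g \<otimes> (x \<otimes> h \<otimes> inv x \<otimes> inv h) \<otimes> inv g) \<in> N"
    by (rule N.m_closed[OF g(2)])
  moreover have "(x \<otimes> g \<otimes> inv x \<otimes> inv g) \<otimes> (g \<otimes> (x \<otimes> h \<otimes> inv x \<otimes> inv h) \<otimes> inv g)
      = x \<otimes> (g \<otimes> h) \<otimes> inv x \<otimes> inv (g \<otimes> h)"
    using g(1) h(1) x by (simp add: inv_mult_group m_assoc mult_inv_cancel_left)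
  ultimately show "g \<otimes> h \<in> {g \<in> carrier G. commute_mod N x g}"
    using g(1) h(1) by (simp add: commute_mod_def)
qed

text \<open>This is the preimage of the center of \<open>G / N\<close>.\<close>

lemma normal_center_mod:
  assumes N: "N \<lhd> G"
  shows "{y \<in> carrier G. \<forall>g\<in>carrier G. commute_mod N y g} \<lhd> G" (is "?C \<lhd> G")
proof (rule normal_invI)
  interpret N: normal N G by fact
  have "?C = (\<Inter>g\<in>carrier G. {y \<in> carrier G. commute_mod N g y})"
    using commute_mod_sym[OF N] one_closed by blast
  moreover have "subgroup (\<Inter>((\<lambda>g. {y \<in> carrier G. commute_mod N g y}) ` carrier G)) G"
    using subgroup_commute_mod[OF N] by (intro subgroups_Inter) auto
  ultimately show "subgroup ?C G" by simp
  fix k y assume k: "k \<in> carrier G" and y: "y \<in> ?C"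
  show "k \<otimes> y \<otimes> inv k \<in> ?C"
  proof (intro CollectI conjI ballI)
    show "k \<otimes> y \<otimes> inv k \<in> carrier G" using k y by auto
    fix g assume g: "g \<in> carrier G"
    define g' where "g' = inv k \<otimes> g \<otimes> k"
    have g': "g' \<in> carrier G" using g k by (simp add: g'_def)
    then have "y \<otimes> g' \<otimes> inv y \<otimes> inv g' \<in> N" using y by (simp add: commute_mod_def)
    then have "k \<otimes> (y \<otimes> g' \<otimes> inv y \<otimes> inv g') \<otimes> inv k \<in> N"
      using N.inv_op_closed2 k by blast
    moreover have "k \<otimes> (y \<otimes> g' \<otimes> inv y \<otimes> inv g') \<otimes> inv k
        = (k \<otimes> y \<otimes> inv k) \<otimes> g \<otimes> inv (k \<otimes> y \<otimes> inv k) \<otimes> inv g"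
      using g k y by (simp add: g'_def inv_mult_group m_assoc mult_inv_cancel_left)
    ultimately show "commute_mod N (k \<otimes> y \<otimes> inv k) g" by (simp add: commute_mod_def)
  qed
qed

lemma conjugate_rcoset:
  assumes W: "W \<lhd> G" and g: "g \<in> carrier G" and x: "x \<in> carrier G"
  shows "conjugate g (W #> x) = W #> (g \<otimes> x \<otimes> inv g)"
proof -
  interpret W: normal W G by fact
  have "conjugate g (W #> x) = (g <# W) #> (x \<otimes> inv g)"
    using g x W.subset by (simp add: conjugate_eq_cosets coset_assoc coset_mult_assoc l_coset_subset_G r_coset_subset_G)
  also have "g <# W = W #> g" using W.coset_eq g by simp
  finally show ?thesis using g x W.subset by (simp add: coset_mult_assoc m_assoc)
qed

text \<open>The center of the nontrivial \<open>p\<close>-group \<open>P / W\<close> is nontrivial: \<open>P\<close> acts on the cosets of \<open>W\<close> by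
conjugation, their number is divisible by \<open>p\<close>, hence so is the number of fixed cosets, and \<open>W\<close> is
one of them.\<close>

lemma ex_commuting_mod_in_p_group:
  assumes p: "prime p" and fin: "finite (carrier G)"
    and P: "subgroup P G" "card P = p ^ a" and W: "W \<lhd> G" "W \<subset> P"
  shows "\<exists>x\<in>P - W. \<forall>g\<in>P. commute_mod W x g"
proof -
  interpret W: normal W G by fact
  interpret P: group "G\<lparr>carrier := P\<rparr>" using P(1) by (rule subgroup_imp_group)
  have Pc: "x \<in> P \<Longrightarrow> x \<in> carrier G" for x using P(1) by (rule subgroup.mem_carrier)
  define E where "E = (\<lambda>x. W #> x) ` P"
  have finP: "finite P" using fin P(1) by (meson finite_subset subgroup.subset)
  have E_eq: "E = rcosets\<^bsub>G\<lparr>carrier := P\<rparr>\<^esub> W"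
    by (auto simp: E_def RCOSETS_def r_coset_def)
  have "subgroup W (G\<lparr>carrier := P\<rparr>)"
    using W(2) P(1) W.subgroup_axioms by (simp add: subgroup_incl)
  from P.lagrange[OF this] have cardE: "card E * card W = p ^ a"
    by (simp add: E_eq order_def P(2))
  have "card W < card P" using W(2) finP by (rule psubset_card_mono[rotated])
  then have "card E \<noteq> 1" using cardE P(2) by auto
  moreover have "card E dvd p ^ a" using cardE by (metis dvd_triv_left)
  ultimately have pE: "p dvd card E"
    using p by (auto simp: divides_primepow_nat)
  have finE: "finite E" using finP by (simp add: E_def)
  have sub: "A \<subseteq> carrier G" if "A \<in> E" for A
    using that Pc r_coset_subset_G[OF W.subset] by (auto simp: E_def)
  have closed: "conjugate g A \<in> E" if "A \<in> E" "g \<in> P" for A g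
  proof -
    obtain x where x: "x \<in> P" "A = W #> x" using \<open>A \<in> E\<close> by (auto simp: E_def)
    then have "conjugate g A = W #> (g \<otimes> x \<otimes> inv g)"
      using conjugate_rcoset[OF W(1)] Pc that(2) by simp
    moreover have "g \<otimes> x \<otimes> inv g \<in> P"
      using x(1) that(2) P(1) by (simp add: subgroup.m_closed subgroup.m_inv_closed)
    ultimately show ?thesis by (auto simp: E_def)
  qed
  define M where "M = {A \<in> E. \<exists>g\<in>P. conjugate g A \<noteq> A}"
  have pM: "p dvd card M"
    unfolding M_def using p_group_moved_points[OF p P finE sub closed] .
  have W1: "W #> \<one> = W" using W.subset by (rule coset_mult_one)
  have "W \<in> E" unfolding E_def using W1 subgroup.one_closed[OF P(1)] by (metis imageI)
  moreover have "W \<notin> M"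
    using W(1) Pc by (auto simp: M_def normal_iff_conjugate[OF W.subgroup_axioms])
  \<comment> \<open>If \<open>W\<close> were the only fixed coset, \<open>p\<close> would divide two consecutive numbers.\<close>
  ultimately have "M \<subseteq> E - {W}" by (auto simp: M_def)
  moreover have "M \<noteq> E - {W}"
  proof
    assume "M = E - {W}"
    then have "card E = card M + 1" using card_Suc_Diff1[OF finE \<open>W \<in> E\<close>] by simp
    then have "p dvd 1" using pE pM by (metis dvd_add_right_iff)
    then show False using p by simp
  qed
  ultimately obtain A where A: "A \<in> E" "A \<noteq> W" "A \<notin> M" by blast
  then obtain x where x: "x \<in> P" "A = W #> x" by (auto simp: E_def)
  have "x \<notin> W" using A(2) x W.rcos_const by auto
  moreover have "commute_mod W x g" if g: "g \<in> P" for g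
  proof -
    have "W #> (g \<otimes> x \<otimes> inv g) = W #> x"
      using A(1,3) g x(2) conjugate_rcoset[OF W(1) Pc[OF g] Pc[OF x(1)]] by (auto simp: M_def)
    moreover have "g \<otimes> x \<otimes> inv g \<in> W #> (g \<otimes> x \<otimes> inv g)"
      using Pc g x(1) by (intro rcos_self W.subgroup_axioms) auto
    ultimately have "g \<otimes> x \<otimes> inv g \<in> W #> x" by simp
    then obtain w where w: "w \<in> W" "g \<otimes> x \<otimes> inv g = w \<otimes> x" by (auto simp: r_coset_def)
    then have "g \<otimes> x \<otimes> inv g \<otimes> inv x = w"
      using Pc x(1) by (simp add: m_assoc)
    then have "commute_mod W g x" using w by (simp add: commute_mod_def)
    then show ?thesis using commute_mod_sym[OF W(1)] Pc g x(1) by blast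
  qed
  ultimately show ?thesis using x(1) by blast
qed

text \<open>Choose a prime whose Sylow subgroup \<open>P\<close> is not contained in \<open>Z\<close>, and an element of \<open>P\<close> that is
central modulo \<open>Z \<inter> P\<close> with respect to \<open>P\<close>. It commutes with the Sylow subgroups for the other
primes, because two normal subgroups of coprime order commute elementwise.\<close>

lemma ex_central_mod_of_normal_sylow:
  assumes fin: "finite (carrier G)"
    and sylow: "\<forall>p P. prime p \<longrightarrow> sylow_subgroup p P \<longrightarrow> P \<lhd> G"
    and Z: "Z \<lhd> G" "Z \<noteq> carrier G"
  shows "\<exists>x\<in>carrier G - Z. \<forall>g\<in>carrier G. commute_mod Z x g"
proof -
  interpret Z: normal Z G by fact
  obtain p where p: "prime p" "\<And>P. sylow_subgroup p P \<Longrightarrow> \<not> P \<subseteq> Z"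
  proof (rule ccontr)
    assume "\<not> thesis"
    then have "\<exists>P. sylow_subgroup p P \<and> P \<subseteq> Z" if "prime p" for p
      using that \<open>\<And>p. prime p \<Longrightarrow> (\<And>P. sylow_subgroup p P \<Longrightarrow> \<not> P \<subseteq> Z) \<Longrightarrow> thesis\<close>
      by metis
    then have "Z = carrier G" by (rule eq_carrier_of_sylow_subgroups[OF fin Z.subgroup_axioms])
    then show False using Z(2) by contradiction
  qed
  obtain P where P: "sylow_subgroup p P" using ex_sylow_subgroup[OF p(1) fin] by blast
  then have sP: "subgroup P G" "card P = p ^ multiplicity p (order G)"
    by (auto simp: sylow_subgroup_def)
  have nP: "P \<lhd> G" using sylow p(1) P by simp
  have "Z \<inter> P \<lhd> G" using Z(1) nP by (rule normal_subgroup_intersect)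
  moreover have "Z \<inter> P \<subset> P" using p(2)[OF P] by blast
  ultimately obtain x where x: "x \<in> P" "x \<notin> Z" and xP: "\<And>g. g \<in> P \<Longrightarrow> commute_mod (Z \<inter> P) x g"
    using ex_commuting_mod_in_p_group[OF p(1) fin sP, of "Z \<inter> P"] by blast
  have xc: "x \<in> carrier G" using x(1) sP(1) by (simp add: subgroup.mem_carrier)
  have "{g \<in> carrier G. commute_mod Z x g} = carrier G"
  proof (rule eq_carrier_of_sylow_subgroups[OF fin subgroup_commute_mod[OF Z(1) xc]])
    fix r :: nat assume r: "prime r"
    show "\<exists>R. sylow_subgroup r R \<and> R \<subseteq> {g \<in> carrier G. commute_mod Z x g}"
    proof (cases "r = p")
      case True
      have "P \<subseteq> {g \<in> carrier G. commute_mod Z x g}"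
        using xP subgroup.mem_carrier[OF sP(1)] by (auto simp: commute_mod_def)
      then show ?thesis using P True by blast
    next
      case False
      obtain R where R: "sylow_subgroup r R" using ex_sylow_subgroup[OF r fin] by blast
      then have sR: "subgroup R G" "card R = r ^ multiplicity r (order G)"
        by (auto simp: sylow_subgroup_def)
      have nR: "R \<lhd> G" using sylow r R by simp
      have cop: "coprime (card P) (card R)"
        using p(1) r False by (simp add: sP(2) sR(2) primes_coprime)
      have "commute_mod Z x g" if g: "g \<in> R" for g
      proof -
        have gc: "g \<in> carrier G" using g sR(1) by (simp add: subgroup.mem_carrier)
        have "g \<otimes> inv x \<otimes> inv g \<in> P"
          using normal.inv_op_closed2[OF nP gc] subgroup.m_inv_closed[OF sP(1) x(1)] by blast
        then have "x \<otimes> (g \<otimes> inv x \<otimes> inv g) \<in> P" using sP(1) x(1) by (simp add: subgroup.m_closed)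
        moreover have "x \<otimes> g \<otimes> inv x \<otimes> inv g \<in> R"
          using normal.inv_op_closed2[OF nR xc g] subgroup.m_inv_closed[OF sR(1) g]
          by (rule subgroup.m_closed[OF sR(1)])
        ultimately have "x \<otimes> g \<otimes> inv x \<otimes> inv g = \<one>"
          using eq_one_of_mem_coprime_subgroups[OF sP(1) sR(1) cop] xc gc by (simp add: m_assoc)
        then show ?thesis by (simp add: commute_mod_def)
      qed
      then show ?thesis using R subgroup.mem_carrier[OF sR(1)] by blast
    qed
  qed
  then show ?thesis using x(2) xc by blast
qed

text \<open>Take \<open>Z\<close> maximal among the normal subgroups that do not contain \<open>N\<close>. The elements that are central
modulo \<open>Z\<close> form a larger normal subgroup, so they contain \<open>N\<close>. But then the commutators of \<open>N\<close>
with \<open>G\<close> lie in \<open>Z\<close>, and these generate \<open>N\<close>.\<close>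

lemma eq_one_of_commutator_subgroup_eq:
  assumes fin: "finite (carrier G)"
    and sylow: "\<forall>p P. prime p \<longrightarrow> sylow_subgroup p P \<longrightarrow> P \<lhd> G"
    and N: "subgroup N G" "commutator_subgroup G N (carrier G) = N"
  shows "N = {\<one>}"
proof (rule ccontr)
  assume "N \<noteq> {\<one>}"
  then have "\<not> N \<subseteq> {\<one>}" using subgroup.one_closed[OF N(1)] by blast
  then have ne: "{Z. Z \<lhd> G \<and> \<not> N \<subseteq> Z} \<noteq> {}" using one_is_normal by blast
  have fin': "finite {Z. Z \<lhd> G \<and> \<not> N \<subseteq> Z}"
  proof (rule finite_subset)
    show "{Z. Z \<lhd> G \<and> \<not> N \<subseteq> Z} \<subseteq> Pow (carrier G)"
    proof
      fix Z assume "Z \<in> {Z. Z \<lhd> G \<and> \<not> N \<subseteq> Z}"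
      then have "subgroup Z G" by (simp add: normal_imp_subgroup)
      then show "Z \<in> Pow (carrier G)" by (simp add: subgroup.subset)
    qed
  qed (use fin in simp)
  obtain Z where "Z \<in> {Z. Z \<lhd> G \<and> \<not> N \<subseteq> Z}"
    and max: "\<forall>Z'\<in>{Z. Z \<lhd> G \<and> \<not> N \<subseteq> Z}. Z \<subseteq> Z' \<longrightarrow> Z = Z'"
    using finite_has_maximal[OF fin' ne] by (elim bexE)
  then have Z: "Z \<lhd> G" "\<not> N \<subseteq> Z" by auto
  interpret Z: normal Z G by fact
  have Nc: "N \<subseteq> carrier G" using N(1) by (rule subgroup.subset)
  have "Z \<noteq> carrier G" using Z(2) Nc by blast
  then have "\<exists>x\<in>carrier G - Z. \<forall>g\<in>carrier G. commute_mod Z x g"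
    by (rule ex_central_mod_of_normal_sylow[OF fin sylow Z(1)])
  then obtain x where x: "x \<in> carrier G" "x \<notin> Z" "\<forall>g\<in>carrier G. commute_mod Z x g"
    by blast
  define C where "C = {y \<in> carrier G. \<forall>g\<in>carrier G. commute_mod Z y g}"
  have "C \<lhd> G" unfolding C_def using Z(1) by (rule normal_center_mod)
  moreover have "Z \<subseteq> C"
  proof
    fix z assume z: "z \<in> Z"
    have "commute_mod Z z g" if g: "g \<in> carrier G" for g
    proof -
      have "g \<otimes> inv z \<otimes> inv g \<in> Z" using z g by (intro Z.inv_op_closed2 Z.m_inv_closed)
      then have "z \<otimes> (g \<otimes> inv z \<otimes> inv g) \<in> Z" by (rule Z.m_closed[OF z])
      then show ?thesis using z g by (simp add: commute_mod_def m_assoc)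
    qed
    then show "z \<in> C" using z by (simp add: C_def)
  qed
  moreover have "x \<in> C" using x by (simp add: C_def)
  ultimately have "C \<lhd> G" "Z \<subseteq> C" "Z \<noteq> C" using x(2) by auto
  then have "N \<subseteq> C" using bspec[OF max, of C] by blast
  then have "(\<Union>h\<in>N. \<Union>k\<in>carrier G. {h \<otimes> k \<otimes> inv h \<otimes> inv k}) \<subseteq> Z"
    unfolding C_def commute_mod_def by blast
  then have "commutator_subgroup G N (carrier G) \<subseteq> Z"
    unfolding commutator_subgroup_def using Z.subgroup_axioms by (rule generate_subgroup_incl)
  then show False using N(2) Z(2) by simp
qed

lemma commutator_subgroup_carrier:
  assumes N: "N \<lhd> G"
  shows "commutator_subgroup G N (carrier G) \<lhd> G" "commutator_subgroup G N (carrier G) \<subseteq> N"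
proof -
  interpret N: normal N G by fact
  let ?S = "\<Union>h\<in>N. \<Union>k\<in>carrier G. {h \<otimes> k \<otimes> inv h \<otimes> inv k}"
  have "?S \<subseteq> N"
  proof clarsimp
    fix h k assume h: "h \<in> N" and k: "k \<in> carrier G"
    have "k \<otimes> inv h \<otimes> inv k \<in> N" using h k by (intro N.inv_op_closed2 N.m_inv_closed)
    then have "h \<otimes> (k \<otimes> inv h \<otimes> inv k) \<in> N" by (rule N.m_closed[OF h])
    then show "h \<otimes> k \<otimes> inv h \<otimes> inv k \<in> N" using h k by (simp add: m_assoc)
  qed
  then show "commutator_subgroup G N (carrier G) \<subseteq> N"
    unfolding commutator_subgroup_def using N.subgroup_axioms by (rule generate_subgroup_incl)
  show "commutator_subgroup G N (carrier G) \<lhd> G"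
    unfolding commutator_subgroup_def
  proof (rule normal_generateI)
    show "?S \<subseteq> carrier G" using \<open>?S \<subseteq> N\<close> N.subset by blast
    fix s g assume "s \<in> ?S" and g: "g \<in> carrier G"
    then obtain h k where hk: "h \<in> N" "k \<in> carrier G" "s = h \<otimes> k \<otimes> inv h \<otimes> inv k"
      by (elim UN_E singletonE)
    have "g \<otimes> s \<otimes> inv g = (g \<otimes> h \<otimes> inv g) \<otimes> (g \<otimes> k \<otimes> inv g)
        \<otimes> inv (g \<otimes> h \<otimes> inv g) \<otimes> inv (g \<otimes> k \<otimes> inv g)"
      using hk g by (simp add: inv_mult_group m_assoc mult_inv_cancel_left)
    moreover have "g \<otimes> h \<otimes> inv g \<in> N" using hk g by (intro N.inv_op_closed2)
    moreover have "g \<otimes> k \<otimes> inv g \<in> carrier G" using hk g by simp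
    ultimately show "g \<otimes> s \<otimes> inv g \<in> ?S"
      by (intro UN_I[of "g \<otimes> h \<otimes> inv g"] UN_I[of "g \<otimes> k \<otimes> inv g"]) simp_all
  qed
qed

lemma normal_lower_central_series: "lower_central_series G i \<lhd> G"
proof (induction i)
  case 0
  show ?case by (simp add: normal_inv_iff subgroup_self)
next
  case (Suc i)
  then show ?case by (simp add: commutator_subgroup_carrier)
qed

text \<open>A term of least cardinality in the lower central series is equal to its successor, hence trivial.\<close>

theorem nilpotent_of_normal_sylow:
  assumes fin: "finite (carrier G)"
    and sylow: "\<forall>p P. prime p \<longrightarrow> sylow_subgroup p P \<longrightarrow> P \<lhd> G"
  shows "nilpotent_group G"
proof -
  let ?L = "lower_central_series G"
  have sub: "subgroup (?L i) G" for i
    using normal_lower_central_series by (rule normal_imp_subgroup)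
  obtain i where i: "\<And>j. card (?L i) \<le> card (?L j)"
    using ex_has_least_nat[of "\<lambda>_. True" 0 "\<lambda>i. card (?L i)"] by blast
  have "?L (Suc i) \<subseteq> ?L i"
    using commutator_subgroup_carrier(2)[OF normal_lower_central_series] by simp
  moreover have "finite (?L i)" using fin sub by (meson finite_subset subgroup.subset)
  ultimately have "?L (Suc i) = ?L i" by (intro card_seteq i)
  then have "commutator_subgroup G (?L i) (carrier G) = ?L i" by simp
  then have "?L i = {\<one>}" by (rule eq_one_of_commutator_subgroup_eq[OF fin sylow sub])
  then show ?thesis unfolding nilpotent_group_def using group_axioms by blast
qed

end

section \<open>Recognizing the groups \<open>\<int>\<^sub>n \<rtimes> \<int>\<^sub>m\<close>\<close>

context group
begin

lemma inverted_by_int_pow: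
  assumes q: "q \<in> carrier G" and x: "x \<in> carrier G" and inv: "x \<otimes> q \<otimes> inv x = inv q"
  shows "x \<otimes> q [^] (a :: int) = q [^] (- a) \<otimes> x"
proof -
  have "x \<otimes> q [^] a \<otimes> inv x = (x \<otimes> q \<otimes> inv x) [^] a"
  proof -
    have "(\<lambda>y. x \<otimes> y \<otimes> inv x) \<in> hom G G"
      using x by (auto simp: hom_def m_assoc mult_inv_cancel_left)
    then interpret h: group_hom G G "\<lambda>y. x \<otimes> y \<otimes> inv x"
      by (simp add: group_hom_def group_hom_axioms_def group_axioms)
    show ?thesis using h.hom_int_pow[OF q] by simp
  qed
  also have "\<dots> = q [^] (- a)" using q by (simp add: inv int_pow_inv int_pow_neg)
  finally have "x \<otimes> q [^] a \<otimes> inv x \<otimes> x = q [^] (- a) \<otimes> x" by simp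
  then show ?thesis using q x by (simp add: m_assoc)
qed

text \<open>This is the multiplication rule of the semidirect product: \<open>x\<^sup>b\<close> acts on the powers of \<open>q\<close> by
\<open>(-1)\<^sup>b\<close>.\<close>

lemma pow_inverts_int_pow:
  assumes q: "q \<in> carrier G" and x: "x \<in> carrier G" and inv: "x \<otimes> q \<otimes> inv x = inv q"
  shows "x [^] (b :: nat) \<otimes> q [^] (a :: int) = q [^] (if even b then a else - a) \<otimes> x [^] b"
proof (induction b)
  case 0
  then show ?case using q by simp
next
  case (Suc b)
  have "x [^] Suc b \<otimes> q [^] a = x \<otimes> (x [^] b \<otimes> q [^] a)"
    unfolding nat_pow_Suc2[OF x] using q x by (simp add: m_assoc)
  also have "\<dots> = x \<otimes> q [^] (if even b then a else - a) \<otimes> x [^] b"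
    using q x by (simp add: Suc.IH m_assoc)
  also have "\<dots> = q [^] (if even (Suc b) then a else - a) \<otimes> (x \<otimes> x [^] b)"
    using q x by (simp add: inverted_by_int_pow[OF q x inv] m_assoc)
  finally show ?case unfolding nat_pow_Suc2[OF x] .
qed

text \<open>The isomorphism sends \<open>(a, b)\<close> to \<open>q\<^sup>a x\<^sup>b\<close>. It is injective because a common power of \<open>q\<close> and
\<open>x\<close> has order dividing the coprime numbers \<open>n\<close> and \<open>m\<close>, and bijective by the orders.\<close>

theorem iso_inversion_semidirect:
  assumes q: "q \<in> carrier G" "ord q = n" and x: "x \<in> carrier G" "ord x = m"
    and inv: "x \<otimes> q \<otimes> inv x = inv q" and order: "order G = n * m"
    and nm: "n > 0" "m > 0" "even m" "coprime n m"
  shows "G \<cong> inversion_semidirect n m"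
proof -
  let ?S = "inversion_semidirect n m"
  interpret S: group ?S using nm(1-3) by (rule group_inversion_semidirect)
  interpret N: comm_group "integer_mod_group n" by simp
  have carS: "carrier ?S = {0..<int n} \<times> {0..<int m}"
    using nm by (simp add: inversion_semidirect_def semidirect_product_def carrier_integer_mod_group)
  have multS: "(a, b) \<otimes>\<^bsub>?S\<^esub> (a', b') = ((a + (if even b then a' else - a')) mod int n, (b + b') mod int m)"
    if "a' \<in> {0..<int n}" "b \<in> {0..<int m}" for a b a' b'
  proof -
    have a': "a' \<in> carrier (integer_mod_group n)" using that nm by (simp add: carrier_integer_mod_group)
    have "((\<lambda>x. inv\<^bsub>integer_mod_group n\<^esub> x) ^^ nat b) a' = (if even (nat b) then a' else (- a') mod int n)"
      using N.funpow_inv[OF a'] a' by simp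
    moreover have "even (nat b) = even b" using that by (simp add: even_nat_iff)
    ultimately show ?thesis
      by (simp add: inversion_semidirect_def semidirect_product_def mod_simps)
  qed
  have qmod: "q [^] (a mod int n) = q [^] a" for a
    using q by (simp add: int_pow_eq)
  have xmod: "x [^] (b mod int m) = x [^] b" for b
    using x by (simp add: int_pow_eq)
  define f where "f = (\<lambda>(a :: int, b :: int). q [^] a \<otimes> x [^] b)"
  have hom: "f \<in> hom ?S G"
  proof (rule homI)
    show "f u \<in> carrier G" for u using q x by (auto simp: f_def split: prod.split)
    fix u v assume "u \<in> carrier ?S" "v \<in> carrier ?S"
    then obtain a b a' b' where u: "u = (a, b)" "b \<in> {0..<int m}" and v: "v = (a', b')" "a' \<in> {0..<int n}"
      by (auto simp: carS)
    let ?s = "if even b then a' else - a'"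
    obtain c where c: "b = int c" using u(2) by (auto elim: nonneg_int_cases)
    have comm: "x [^] b \<otimes> q [^] a' = q [^] ?s \<otimes> x [^] b"
      using pow_inverts_int_pow[OF q(1) x(1) inv, of c a'] by (simp add: c int_pow_int)
    have "f (u \<otimes>\<^bsub>?S\<^esub> v) = q [^] (a + ?s) \<otimes> x [^] (b + b')"
      using u v by (simp add: f_def multS qmod xmod)
    also have "\<dots> = q [^] a \<otimes> (q [^] ?s \<otimes> x [^] b) \<otimes> x [^] b'"
      using q x by (simp add: int_pow_mult m_assoc)
    also have "\<dots> = f u \<otimes> f v"
      unfolding comm[symmetric] using q x u v by (simp add: f_def m_assoc)
    finally show "f (u \<otimes>\<^bsub>?S\<^esub> v) = f u \<otimes> f v" .
  qed
  interpret f: group_hom ?S G f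
    by (simp add: group_hom_def group_hom_axioms_def S.group_axioms group_axioms hom)
  have one: "\<one>\<^bsub>?S\<^esub> = (0, 0)" by (simp add: inversion_semidirect_def semidirect_product_def)
  \<comment> \<open>An element of the kernel gives an element that is a power of both \<open>q\<close> and \<open>x\<close>.\<close>
  have inj: "inj_on f (carrier ?S)"
  proof (rule f.inj_on_one_iff[THEN iffD2], intro allI impI)
    fix u assume u: "u \<in> carrier ?S" "f u = \<one>"
    then obtain a b where ab: "u = (a, b)" "a \<in> {0..<int n}" "b \<in> {0..<int m}" by (auto simp: carS)
    have qx: "q [^] a \<otimes> x [^] b = \<one>" using u ab by (simp add: f_def)
    then have eq: "q [^] a = x [^] (- b)" using q x by (simp add: int_pow_neg inv_equality inv_unique')
    let ?z = "q [^] a"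
    have z: "?z \<in> carrier G" using q by simp
    have "?z [^] int n = \<one>" using q by (simp add: int_pow_pow int_pow_eq_id)
    then have zn: "?z [^] n = \<one>" by (simp add: int_pow_int)
    have "?z [^] int m = \<one>" unfolding eq using x by (simp add: int_pow_pow int_pow_eq_id)
    then have zm: "?z [^] m = \<one>" by (simp add: int_pow_int)
    have z1: "?z = \<one>" using eq_one_of_coprime_powers[OF z zn zm nm(4)] .
    then have "int n dvd a" using q by (simp add: int_pow_eq_id)
    then have "a mod int n = 0" by simp
    then have "a = 0" using ab(2) by simp
    moreover have "x [^] b = \<one>" using qx z1 x by simp
    then have "int m dvd b" using x by (simp add: int_pow_eq_id)
    then have "b mod int m = 0" by simp
    then have "b = 0" using ab(3) by simp
    ultimately show "u = \<one>\<^bsub>?S\<^esub>" using ab(1) one by simp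
  qed
  have fin: "finite (carrier G)" using order nm by (simp flip: order_gt_0_iff_finite)
  have "f ` carrier ?S = carrier G"
  proof (rule card_seteq[OF fin])
    show "f ` carrier ?S \<subseteq> carrier G" using f.hom_closed by blast
    show "card (carrier G) \<le> card (f ` carrier ?S)"
      unfolding card_image[OF inj] using order by (simp add: carS card_cartesian_product order_def)
  qed
  then have "f \<in> iso ?S G" using hom inj by (simp add: iso_def bij_betw_def)
  then have "?S \<cong> G" by (auto simp: is_iso_def)
  then show ?thesis by (rule S.iso_sym)
qed

end

text \<open>The 3-cycle \<open>q\<close> is inverted by the transposition \<open>x\<close>.\<close>

lemma sym_group_3_iso_inversion_semidirect: "sym_group 3 \<cong> inversion_semidirect 3 2"
proof -
  interpret group "sym_group 3" by (rule sym_group_is_group)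
  define x :: "nat \<Rightarrow> nat" where "x = transpose 1 2"
  define q :: "nat \<Rightarrow> nat" where "q = transpose 1 2 \<circ> transpose 2 3"
  have x: "x \<in> carrier (sym_group 3)"
    by (simp add: x_def sym_group_carrier permutes_swap_id)
  have y: "transpose 2 3 \<in> carrier (sym_group 3)"
    by (simp add: sym_group_carrier permutes_swap_id)
  have q: "q \<in> carrier (sym_group 3)"
    using m_closed[OF x y] by (simp add: q_def x_def sym_group_mult)
  have q3: "q \<circ> (q \<circ> q) = id" by (auto simp: q_def fun_eq_iff transpose_def)
  have x2: "x \<circ> x = id" by (simp add: x_def)
  have xqxq: "x \<circ> q \<circ> x \<circ> q = id" by (auto simp: q_def x_def fun_eq_iff transpose_def)
  have "q 3 \<noteq> id 3" "x 1 \<noteq> id 1" by (simp_all add: q_def x_def transpose_def)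
  then have ne: "q \<noteq> id" "x \<noteq> id" by metis+
  have "q [^]\<^bsub>sym_group 3\<^esub> (3::nat) = \<one>\<^bsub>sym_group 3\<^esub>"
    using q3 by (simp add: numeral_3_eq_3 sym_group_mult sym_group_one comp_assoc)
  then have "ord q dvd 3" using q pow_eq_id by blast
  moreover have "ord q \<noteq> 1" using ord_eq_1[OF q] ne by (simp add: sym_group_one)
  ultimately have oq: "ord q = 3" using prime_nat_iff[of 3] by auto
  have "x [^]\<^bsub>sym_group 3\<^esub> (2::nat) = \<one>\<^bsub>sym_group 3\<^esub>"
    using x2 by (simp add: numeral_2_eq_2 sym_group_mult sym_group_one)
  then have "ord x dvd 2" using x pow_eq_id by blast
  moreover have "ord x \<noteq> 1" using ord_eq_1[OF x] ne by (simp add: sym_group_one)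
  ultimately have ox: "ord x = 2" using prime_nat_iff[of 2] by auto
  have ix: "inv\<^bsub>sym_group 3\<^esub> x = x"
    using x2 x by (intro inv_equality) (simp_all add: sym_group_mult sym_group_one)
  have "x \<otimes>\<^bsub>sym_group 3\<^esub> q \<otimes>\<^bsub>sym_group 3\<^esub> inv\<^bsub>sym_group 3\<^esub> x = inv\<^bsub>sym_group 3\<^esub> q"
    unfolding ix using xqxq q x
    by (intro inv_equality[symmetric] m_closed) (simp_all add: sym_group_mult sym_group_one)
  moreover have "order (sym_group 3) = 3 * 2"
    using card_permutations[of "{1..3::nat}" 3] by (simp add: order_def sym_group_def fact_numeral)
  moreover have "coprime 3 (2::nat)" by simp
  ultimately show ?thesis
    using iso_inversion_semidirect[OF q oq x ox] by simp
qed

section \<open>Independent sets of subgroups\<close>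

context group
begin

lemma subgroup_set_mult_self:
  assumes H: "subgroup H G"
  shows "H <#> H = H"
proof -
  interpret H: group "G\<lparr>carrier := H\<rparr>" using H by (rule subgroup_imp_group)
  show ?thesis using set_mult_subgroup_idem[OF H, of H] H.subgroup_self by simp
qed

text \<open>Write \<open>g h\<inverse>\<close> as a product of an element of \<open>g M g\<inverse>\<close> and one of \<open>h M h\<inverse>\<close>. Cancelling \<open>g\<close> and
\<open>h\<inverse>\<close> shows \<open>g\<inverse> h \<in> M\<close>. So both conjugates are the same subgroup, which is its own product
with itself, so it is \<open>G\<close>, and conjugating back gives \<open>M = G\<close>.\<close>

lemma conjugate_mult_conjugate_neq_carrier:
  assumes M: "subgroup M G" "M \<noteq> carrier G" and g: "g \<in> carrier G" and h: "h \<in> carrier G"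
  shows "conjugate g M <#> conjugate h M \<noteq> carrier G"
proof
  assume eq: "conjugate g M <#> conjugate h M = carrier G"
  have Mc: "M \<subseteq> carrier G" using M(1) by (rule subgroup.subset)
  have "g \<otimes> inv h \<in> conjugate g M <#> conjugate h M" using eq g h by simp
  then obtain a b where ab: "a \<in> M" "b \<in> M"
      "g \<otimes> inv h = (g \<otimes> a \<otimes> inv g) \<otimes> (h \<otimes> b \<otimes> inv h)"
    by (auto simp: set_mult_def conjugate_def)
  have c: "a \<in> carrier G" "b \<in> carrier G" using ab Mc by auto
  have "inv g \<otimes> (g \<otimes> inv h) \<otimes> h = inv g \<otimes> ((g \<otimes> a \<otimes> inv g) \<otimes> (h \<otimes> b \<otimes> inv h)) \<otimes> h"
    by (simp only: ab(3))
  moreover have "inv g \<otimes> (g \<otimes> inv h) \<otimes> h = \<one>"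
    using g h by (simp add: m_assoc mult_inv_cancel_left)
  moreover have "inv g \<otimes> ((g \<otimes> a \<otimes> inv g) \<otimes> (h \<otimes> b \<otimes> inv h)) \<otimes> h = a \<otimes> (inv g \<otimes> h) \<otimes> b"
    using g h c by (simp add: m_assoc mult_inv_cancel_left)
  ultimately have "a \<otimes> (inv g \<otimes> h) \<otimes> b = \<one>" by simp
  moreover have "inv a \<otimes> (a \<otimes> (inv g \<otimes> h) \<otimes> b) \<otimes> inv b = inv g \<otimes> h"
    using g h c by (simp add: m_assoc mult_inv_cancel_left)
  ultimately have "inv g \<otimes> h = inv a \<otimes> inv b" using c by simp
  then have k: "inv g \<otimes> h \<in> M"
    using M(1) ab by (simp add: subgroup.m_closed subgroup.m_inv_closed)
  have "conjugate h M = conjugate g M"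
    using conjugate_self[OF M(1) k] conjugate_eq_iff[OF h g Mc] by simp
  then have "conjugate g M = carrier G"
    using eq subgroup_set_mult_self[OF subgroup_conjugate[OF g M(1)]] by simp
  then have "M = conjugate (inv g) (carrier G)"
    using conjugate_inv_cancel[OF g Mc] by simp
  moreover have "conjugate (inv g) (carrier G) = carrier G"
    using g by (intro conjugate_self subgroup_self) auto
  ultimately show False using M(2) by simp
qed

lemma card_set_mult_le:
  assumes "finite H" "finite K"
  shows "card (H <#> K) \<le> card H * card K"
proof -
  have "H <#> K = (\<lambda>(h, k). h \<otimes> k) ` (H \<times> K)" by (auto simp: set_mult_def)
  then show ?thesis using card_image_le[of "H \<times> K" "\<lambda>(h, k). h \<otimes> k"] assms
    by (simp add: card_cartesian_product)
qed

end

locale small_independence_group = group +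
  assumes finite_carrier: "finite (carrier G)"
    and independence: "independence_number (comaximal_subgroup_graph G) \<le> 6"
begin

lemma finite_subgroup: "subgroup H G \<Longrightarrow> finite H"
  by (rule finite_subset[OF subgroup.subset finite_carrier])

lemma card_pairwise_non_comaximal:
  assumes F: "\<And>H. H \<in> F \<Longrightarrow> subgroup H G" "\<And>H. H \<in> F \<Longrightarrow> H \<noteq> {\<one>}"
      "\<And>H. H \<in> F \<Longrightarrow> H \<noteq> carrier G"
    and nc: "\<And>H K. H \<in> F \<Longrightarrow> K \<in> F \<Longrightarrow> H <#> K \<noteq> carrier G"
  shows "finite F" "card F \<le> 6"
proof -
  have vertices: "F \<subseteq> nontrivial_proper_subgroups G"
    using F by (auto simp: nontrivial_proper_subgroups_def)
  have "nontrivial_proper_subgroups G \<subseteq> Pow (carrier G)"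
    by (auto simp: nontrivial_proper_subgroups_def dest: subgroup.mem_carrier)
  then have fin: "finite (nontrivial_proper_subgroups G)"
    by (rule finite_subset) (simp add: finite_carrier)
  then show "finite F" using vertices by (rule rev_finite_subset)
  have "independent_set (comaximal_subgroup_graph G) F"
    unfolding independent_set_def
  proof (intro conjI ballI impI)
    show "F \<subseteq> fst (comaximal_subgroup_graph G)"
      using vertices by (simp add: comaximal_subgroup_graph_def)
    fix H K assume HK: "H \<in> F" "K \<in> F" "H \<noteq> K"
    then have "H \<in> nontrivial_proper_subgroups G" "K \<in> nontrivial_proper_subgroups G"
      using vertices by auto
    then show "{H, K} \<notin> snd (comaximal_subgroup_graph G)"
      using comaximal_subgroup_graph_adjacent_iff[of H K] HK(3) nc[OF HK(1,2)] by simp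
  qed
  then show "card F \<le> 6"
    using independence independence_number_le_iff[of "comaximal_subgroup_graph G" 6] fin
    by (simp add: comaximal_subgroup_graph_def)
qed

text \<open>The main counting principle. A product of two members of the family lies in a product of two
conjugates of \<open>M\<close>, which is not all of \<open>G\<close>.\<close>

lemma card_subgroups_below_conjugates:
  assumes M: "subgroup M G" "M \<noteq> carrier G"
    and F: "\<And>H. H \<in> F \<Longrightarrow> subgroup H G" "\<And>H. H \<in> F \<Longrightarrow> H \<noteq> {\<one>}"
      "\<And>H. H \<in> F \<Longrightarrow> \<exists>g\<in>carrier G. H \<subseteq> conjugate g M"
  shows "finite F" "card F \<le> 6"
proof -
  have nc: "H <#> K \<noteq> carrier G" if HK: "H \<in> F" "K \<in> F" for H K
  proof
    assume eq: "H <#> K = carrier G"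
    obtain g where g: "g \<in> carrier G" "H \<subseteq> conjugate g M" using F(3)[OF HK(1)] by blast
    obtain h where h: "h \<in> carrier G" "K \<subseteq> conjugate h M" using F(3)[OF HK(2)] by blast
    have "carrier G \<subseteq> conjugate g M <#> conjugate h M"
      using mono_set_mult[OF g(2) h(2), of G] eq by simp
    moreover have "conjugate g M <#> conjugate h M \<subseteq> carrier G"
      using g(1) h(1) M(1) by (intro setmult_subset_G conjugate_subset) (auto dest: subgroup.mem_carrier)
    ultimately show False
      using conjugate_mult_conjugate_neq_carrier[OF M g(1) h(1)] by simp
  qed
  moreover have "H \<noteq> carrier G" if H: "H \<in> F" for H
  proof
    assume "H = carrier G"
    then have "H <#> H = carrier G"
      using subgroup_set_mult_self[OF subgroup_self] by simp
    then show False using nc[OF H H] by simp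
  qed
  ultimately show "finite F" "card F \<le> 6"
    using card_pairwise_non_comaximal[of F] F(1,2) by simp_all
qed

end

section \<open>Sylow subgroups that are not normal\<close>

context group
begin

lemma normalizer_contains:
  assumes "subgroup H G"
  shows "H \<subseteq> normalizer G H"
  using conjugate_self[OF assms] subgroup.mem_carrier[OF assms]
  by (auto simp: normalizer_eq[OF subgroup.subset[OF assms]])

lemma conjugate_neq_one:
  assumes "subgroup H G" "H \<noteq> {\<one>}" "g \<in> carrier G"
  shows "conjugate g H \<noteq> {\<one>}"
proof
  assume "conjugate g H = {\<one>}"
  then have "conjugate (inv g) {\<one>} = H"
    using conjugate_inv_cancel[OF assms(3) subgroup.subset[OF assms(1)]] by simp
  then show False using assms(2,3) by (simp add: conjugate_def)
qed

lemma subgroup_neq_one_iff_card: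
  "subgroup H G \<Longrightarrow> H \<noteq> {\<one>} \<longleftrightarrow> card H \<noteq> 1"
  using subgroup.one_closed[of H G] by (auto simp: card_1_singleton_iff)

text \<open>If \<open>P\<close> normalized \<open>T\<close>, it would centralize its only nontrivial element \<open>t\<close>. Then \<open>t\<close> would
normalize \<open>P\<close> and hence lie in \<open>P\<close>, a group of odd order.\<close>

lemma ex_moving_order_two_subgroup:
  assumes T: "subgroup T G" "card T = 2" and P: "subgroup P G" "odd (card P)"
    and self: "normalizer G P = P"
  shows "\<exists>x\<in>P. conjugate x T \<noteq> T"
proof (rule ccontr)
  assume "\<not> (\<exists>x\<in>P. conjugate x T \<noteq> T)"
  then have fix_T: "\<And>x. x \<in> P \<Longrightarrow> conjugate x T = T" by blast
  have "\<exists>t\<in>T. t \<noteq> \<one>"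
    using subgroup_neq_one_iff_card[OF T(1)] T(2) subgroup.one_closed[OF T(1)] by auto
  then obtain t where t: "t \<in> T" "t \<noteq> \<one>" by blast
  have tc: "t \<in> carrier G" using T(1) t(1) by (rule subgroup.mem_carrier)
  have "{\<one>, t} = T"
    using T t(1,2) subgroup.one_closed[OF T(1)] by (intro card_subset_eq) (auto intro: card_ge_0_finite)
  then have T_eq: "T = {\<one>, t}" by simp
  have comm: "t \<otimes> x \<otimes> inv t = x" if x: "x \<in> P" for x
  proof -
    have xc: "x \<in> carrier G" using P(1) x by (rule subgroup.mem_carrier)
    have "x \<otimes> t \<otimes> inv x \<in> T" using fix_T[OF x] t(1) by (auto simp: conjugate_def)
    moreover have "x \<otimes> t \<otimes> inv x \<noteq> \<one>"
    proof
      assume *: "x \<otimes> t \<otimes> inv x = \<one>"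
      have "inv x \<otimes> (x \<otimes> t \<otimes> inv x) \<otimes> x = t"
        using xc tc by (simp add: m_assoc mult_inv_cancel_left)
      then show False using * xc t(2) by simp
    qed
    ultimately have "x \<otimes> t \<otimes> inv x = t" using T_eq by simp
    then have "x \<otimes> t \<otimes> inv x \<otimes> x = t \<otimes> x" by simp
    then have "x \<otimes> t = t \<otimes> x" using xc tc by (simp add: m_assoc)
    then have "x \<otimes> t \<otimes> inv t = t \<otimes> x \<otimes> inv t" by simp
    then show ?thesis using xc tc by (simp add: m_assoc)
  qed
  have "conjugate t P = P" using comm by (simp add: conjugate_def)
  then have "t \<in> P"
    using self normalizer_eq[OF subgroup.subset[OF P(1)]] tc by blast
  moreover have "coprime (card T) (card P)" using P(2) T(2) by simp
  ultimately show False
    using eq_one_of_mem_coprime_subgroups[OF T(1) P(1) _ t(1)] t(2) by blast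
qed

end

context small_independence_group
begin

text \<open>The normalizer \<open>N\<close> of \<open>P\<close> has exactly as many conjugates as \<open>P\<close>, because \<open>P\<close> is its only Sylow
\<open>p\<close>-subgroup. If \<open>N\<close> is larger than \<open>P\<close>, its order has a prime divisor \<open>r\<close> other than \<open>p\<close>, and the
conjugates of \<open>P\<close>, those of \<open>N\<close> and a subgroup of order \<open>r\<close> are at least \<open>3 + 3 + 1\<close> subgroups.\<close>

lemma non_normal_sylow:
  assumes p: "prime p" and P: "sylow_subgroup p P" and nn: "\<not> P \<lhd> G"
  shows "3 \<le> card (conjugates P)" "card (conjugates P) \<le> 6" "normalizer G P = P" "P \<noteq> {\<one>}"
proof -
  have sP: "subgroup P G" and cardP: "card P = p ^ multiplicity p (order G)"
    using P by (auto simp: sylow_subgroup_def)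
  have Pc: "P \<subseteq> carrier G" using sP by (rule subgroup.subset)
  show P1: "P \<noteq> {\<one>}" using nn one_is_normal by auto
  define N where "N = normalizer G P"
  have sN: "subgroup N G" unfolding N_def using Pc by (rule normalizer_imp_subgroup)
  have Nc: "N \<subseteq> carrier G" using sN by (rule subgroup.subset)
  have N_eq: "N = {g \<in> carrier G. conjugate g P = P}" unfolding N_def using Pc by (rule normalizer_eq)
  have NG: "N \<noteq> carrier G"
    using nn normal_iff_conjugate[OF sP] by (auto simp: N_eq)
  have PN: "P \<subseteq> N" unfolding N_def using sP by (rule normalizer_contains)
  define n where "n = card (conjugates P)"
  have conjP: "H \<in> conjugates P \<Longrightarrow> subgroup H G \<and> card H = card P \<and> H \<noteq> {\<one>} \<and> (\<exists>g\<in>carrier G. H \<subseteq> conjugate g N)" for H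
  proof -
    assume "H \<in> conjugates P"
    then obtain g where g: "g \<in> carrier G" "H = conjugate g P" by (auto simp: conjugates_def)
    show ?thesis
      unfolding g(2) using conjugate_mono[OF PN, of g] conjugate_neq_one[OF sP P1 g(1)]
        subgroup_conjugate[OF g(1) sP] card_conjugate[OF g(1) Pc] g(1) by blast
  qed
  have finP: "finite (conjugates P)" using finite_carrier by (simp add: conjugates_def)
  have n6: "n \<le> 6"
    unfolding n_def by (rule card_subgroups_below_conjugates(2)[OF sN NG]) (use conjP in blast)+
  have "n \<noteq> 1" using nn card_conjugates_eq_1_iff[OF sP finite_carrier] by (simp add: n_def)
  moreover have "n \<noteq> 0" using conjugates_self[OF Pc] finP by (auto simp: n_def)
  moreover have "p dvd n - 1" unfolding n_def using p finite_carrier P by (rule sylow_card_conjugates_mod)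
  ultimately have n3: "3 \<le> n" using p prime_ge_2_nat[OF p] dvd_imp_le[of p "n - 1"] by linarith
  show "3 \<le> card (conjugates P)" "card (conjugates P) \<le> 6" using n3 n6 by (auto simp: n_def)
  \<comment> \<open>Whatever normalizes \<open>N\<close> permutes the Sylow subgroups of \<open>N\<close>, and \<open>P\<close> is the only one.\<close>
  have NN: "normalizer G N = N"
  proof
    show "N \<subseteq> normalizer G N" using sN by (rule normalizer_contains)
    show "normalizer G N \<subseteq> N"
    proof
      fix g assume "g \<in> normalizer G N"
      then have g: "g \<in> carrier G" "conjugate g N = N" by (auto simp: normalizer_eq[OF Nc])
      have "conjugate g P \<subseteq> N" using conjugate_mono[OF PN, of g] g(2) by simp
      then have "conjugate g P = P"
        using sylow_normalizing_sylow[OF p finite_carrier P sylow_subgroup_conjugate[OF g(1) P]]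
        by (auto simp: N_eq)
      then show "g \<in> N" using g(1) by (simp add: N_eq)
    qed
  qed
  have "card N > 0" using sN finite_carrier by (rule subgroup.finite_imp_card_positive)
  then have cardconjN: "card (conjugates N) = n"
    using card_conjugates[OF Nc] card_conjugates[OF Pc] unfolding NN n_def N_def[symmetric]
    by (metis mult_cancel2 not_gr_zero)
  have conjN: "H \<in> conjugates N \<Longrightarrow> subgroup H G \<and> card H = card N \<and> (\<exists>g\<in>carrier G. H \<subseteq> conjugate g N)" for H
  proof -
    assume "H \<in> conjugates N"
    then obtain g where g: "g \<in> carrier G" "H = conjugate g N" by (auto simp: conjugates_def)
    show ?thesis
      unfolding g(2) using subgroup_conjugate[OF g(1) sN] card_conjugate[OF g(1) Nc] g(1) by blast
  qed
  show "normalizer G P = P"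
  proof (rule ccontr)
    assume "normalizer G P \<noteq> P"
    then have NP: "N \<noteq> P" by (simp add: N_def)
    have "card P dvd card N" using sP sN PN by (rule card_subgroup_dvd)
    then obtain m where m: "card N = card P * m" by (auto simp: dvd_def)
    have Ppos: "card P > 1"
      using subgroup_neq_one_iff_card[OF sP] P1 subgroup.finite_imp_card_positive[OF sP finite_carrier] by simp
    have "m \<noteq> 1" using m NP card_subset_eq[OF finite_subgroup[OF sN] PN] by auto
    then obtain r where r: "prime r" "r dvd m" using prime_factor_nat by blast
    have rp: "r \<noteq> p"
    proof
      assume "r = p"
      then have "card P * p dvd card N" using r(2) m by simp
      also have "card N dvd order G"
        unfolding order_def using sN subgroup_self Nc by (rule card_subgroup_dvd)
      finally have "p ^ Suc (multiplicity p (order G)) dvd order G" by (simp add: cardP mult.commute)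
      moreover have "order G \<noteq> 0" using finite_carrier by (simp add: order_gt_0_iff_finite)
      moreover have "\<not> is_unit p" using p by auto
      ultimately have "Suc (multiplicity p (order G)) \<le> multiplicity p (order G)"
        by (intro multiplicity_geI) auto
      then show False by simp
    qed
    have "r ^ 1 dvd card N" using r(2) m by simp
    from ex_subgroup_prime_power_card[OF r(1) finite_carrier sN this] obtain R
      where R: "subgroup R G" "R \<subseteq> N" "card R = r" by auto
    have "r \<noteq> card P"
    proof
      assume "r = card P"
      then have "r dvd p ^ multiplicity p (order G)" by (simp add: cardP)
      then have "r dvd p" using r(1) prime_dvd_power by blast
      then show False using primes_dvd_imp_eq[OF r(1) p] rp by simp
    qed
    moreover have "r \<noteq> card N"
    proof
      assume "r = card N"
      then have "card P * m dvd m" using r(2) m by simp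
      moreover have "m > 0" using m \<open>card N > 0\<close> by (cases m) auto
      ultimately have "card P * m \<le> 1 * m" using dvd_imp_le[of "card P * m" m] by simp
      then show False using Ppos \<open>m > 0\<close> by simp
    qed
    moreover have PneN: "card P \<noteq> card N"
      using NP card_subset_eq[OF finite_subgroup[OF sN] PN] by auto
    ultimately have ne: "r \<noteq> card P" "r \<noteq> card N" "card P \<noteq> card N" by simp_all
    have cards: "\<forall>H\<in>conjugates P. card H = card P" "\<forall>H\<in>conjugates N. card H = card N"
      using conjP conjN by simp_all
    have disj: "conjugates P \<inter> conjugates N = {}" "R \<notin> conjugates P \<union> conjugates N"
      using cards R(3) ne by auto
    have R1: "R \<noteq> {\<one>}" using subgroup_neq_one_iff_card[OF R(1)] R(3) r(1) by auto
    have N1: "H \<noteq> {\<one>}" if "H \<in> conjugates N" for H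
    proof -
      have "card H \<noteq> 1" using conjN[OF that] m Ppos by simp
      then show ?thesis using conjN[OF that] subgroup_neq_one_iff_card by simp
    qed
    have R2: "R \<subseteq> conjugate \<one> N" using R(2) conjugate_one[OF Nc] by simp
    have "card (insert R (conjugates P \<union> conjugates N)) \<le> 6"
    proof (rule card_subgroups_below_conjugates(2)[OF sN NG])
      fix H assume "H \<in> insert R (conjugates P \<union> conjugates N)"
      then consider "H = R" | "H \<in> conjugates P" | "H \<in> conjugates N" by blast
      then have "subgroup H G \<and> H \<noteq> {\<one>} \<and> (\<exists>g\<in>carrier G. H \<subseteq> conjugate g N)"
      proof cases
        case 1
        then show ?thesis using R(1) R1 R2 one_closed by blast
      next
        case 2
        then show ?thesis using conjP by simp
      next
        case 3
        then show ?thesis using conjN N1 by simp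
      qed
      then show "subgroup H G" "H \<noteq> {\<one>}" "\<exists>g\<in>carrier G. H \<subseteq> conjugate g N" by blast+
    qed
    moreover have "finite (conjugates P)" "finite (conjugates N)"
      using finite_carrier by (simp_all add: conjugates_def)
    ultimately show False
      using disj n3 cardconjN by (simp add: card_Un_disjoint n_def[symmetric])
  qed
qed

lemma order_eq_conjugates_times_sylow:
  assumes p: "prime p" and P: "sylow_subgroup p P" and nn: "\<not> P \<lhd> G"
  shows "order G = card (conjugates P) * card P"
proof -
  have "P \<subseteq> carrier G" using P by (simp add: sylow_subgroup_def subgroup.subset)
  from card_conjugates[OF this] show ?thesis by (simp add: non_normal_sylow(3)[OF assms])
qed

text \<open>For odd \<open>p\<close> the conditions \<open>n \<equiv> 1\<close> modulo \<open>p\<close> and \<open>3 \<le> n \<le> 6\<close> leave \<open>n = 4\<close> and \<open>n = 6\<close>, so \<open>G\<close> has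
a subgroup \<open>T\<close> of order 2. Its orbit under \<open>P\<close> has odd size greater than 1. A product of \<open>T\<close> with
a conjugate of \<open>P\<close> has at most \<open>2 \<cdot> |P|\<close> elements, fewer than \<open>G\<close>, so the orbit of \<open>T\<close> joins the
\<open>n \<ge> 4\<close> conjugates of \<open>P\<close> in an independent set with at least 7 members.\<close>

lemma odd_sylow_normal:
  assumes p: "prime p" "odd p" and P: "sylow_subgroup p P"
  shows "P \<lhd> G"
proof (rule ccontr)
  assume nn: "\<not> P \<lhd> G"
  have sP: "subgroup P G" and cardP: "card P = p ^ multiplicity p (order G)"
    using P by (auto simp: sylow_subgroup_def)
  have Pc: "P \<subseteq> carrier G" using sP by (rule subgroup.subset)
  define n where "n = card (conjugates P)"
  have n: "3 \<le> n" "n \<le> 6" "normalizer G P = P" "P \<noteq> {\<one>}"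
    using non_normal_sylow[OF p(1) P nn] by (auto simp: n_def)
  have order: "order G = n * card P"
    unfolding n_def using p(1) P nn by (rule order_eq_conjugates_times_sylow)
  have oddP: "odd (card P)" using p(2) by (simp add: cardP)
  have "card P \<noteq> 1" using n(4) subgroup_neq_one_iff_card[OF sP] by simp
  moreover have "card P > 0" using sP finite_carrier by (rule subgroup.finite_imp_card_positive)
  ultimately have P3: "3 \<le> card P" using oddP by (cases "card P = 2") auto
  have pdvd: "p dvd n - 1" unfolding n_def using p(1) finite_carrier P by (rule sylow_card_conjugates_mod)
  have "even n"
  proof (rule ccontr)
    assume "odd n"
    then have "n = 3 \<or> n = 5" using n(1,2) by presburger
    \<comment> \<open>\<open>n - 1\<close> is 2 or 4, so its only prime divisor is 2.\<close>
    then have "p dvd 2 ^ 2" using pdvd dvd_trans[of p 2 "2 ^ 2"] by auto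
    then have "p dvd 2" using p(1) prime_dvd_power_nat by blast
    then show False using p primes_dvd_imp_eq[of p 2] by auto
  qed
  then have n4: "4 \<le> n" using n(1) by presburger
  have "2 ^ 1 dvd card (carrier G)" using order \<open>even n\<close> by (simp add: order_def)
  from ex_subgroup_prime_power_card[OF two_is_prime_nat finite_carrier subgroup_self this] obtain T
    where T: "subgroup T G" "card T = 2" by auto
  have Tc: "T \<subseteq> carrier G" using T(1) by (rule subgroup.subset)
  define orbit_T where "orbit_T = (\<lambda>g. conjugate g T) ` P"
  have orbit_T: "subgroup H G \<and> card H = 2" if "H \<in> orbit_T" for H
  proof -
    obtain g where g: "g \<in> carrier G" "H = conjugate g T" using \<open>H \<in> orbit_T\<close> Pc by (auto simp: orbit_T_def)
    show ?thesis
      unfolding g(2) using subgroup_conjugate[OF g(1) T(1)] card_conjugate[OF g(1) Tc] T(2) by simp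
  qed
  have finite_orbit: "finite orbit_T" using finite_subgroup[OF sP] by (simp add: orbit_T_def)
  have card_orbit: "3 \<le> card orbit_T"
  proof -
    have dvd: "card orbit_T dvd card P"
      unfolding orbit_T_def by (rule dvdI[OF conjugates_orbit_stabilizer[OF sP Tc, symmetric]])
    obtain x where x: "x \<in> P" "conjugate x T \<noteq> T"
      using ex_moving_order_two_subgroup[OF T sP oddP n(3)] by blast
    have "T \<in> orbit_T" unfolding orbit_T_def
      using conjugate_one[OF Tc] subgroup.one_closed[OF sP] by (metis imageI)
    moreover have "conjugate x T \<in> orbit_T" using x(1) by (simp add: orbit_T_def)
    ultimately have "card {T, conjugate x T} \<le> card orbit_T" using finite_orbit by (intro card_mono) auto
    then have "2 \<le> card orbit_T" using x(2) by auto
    moreover have "card orbit_T \<noteq> 2" using dvd oddP by auto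
    ultimately show ?thesis by simp
  qed
  have conjP: "subgroup H G \<and> card H = card P" if "H \<in> conjugates P" for H
  proof -
    obtain g where g: "g \<in> carrier G" "H = conjugate g P" using \<open>H \<in> conjugates P\<close> by (auto simp: conjugates_def)
    show ?thesis
      unfolding g(2) using subgroup_conjugate[OF g(1) sP] card_conjugate[OF g(1) Pc] by simp
  qed
  have "carrier G \<lhd> G" by (simp add: normal_inv_iff subgroup_self)
  then have PG: "P \<noteq> carrier G" using nn by metis
  have order_small: "4 * card P \<le> order G" using order n4 by simp
  have small: "H <#> K \<noteq> carrier G"
    if "subgroup H G" "subgroup K G" "card H * card K < order G" for H K
  proof
    assume "H <#> K = carrier G"
    then have "order G \<le> card H * card K"
      using card_set_mult_le[of H K] finite_subgroup that by (simp add: order_def)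
    then show False using that(3) by simp
  qed
  have "finite (conjugates P)" using finite_carrier by (simp add: conjugates_def)
  moreover have "card (conjugates P \<union> orbit_T) \<le> 6"
  proof (rule card_pairwise_non_comaximal(2))
    fix H assume H: "H \<in> conjugates P \<union> orbit_T"
    then have cH: "subgroup H G \<and> (card H = card P \<or> card H = 2)" using conjP[of H] orbit_T[of H] by blast
    then show "subgroup H G" by simp
    have "card H \<noteq> 1" using cH P3 by linarith
    then show "H \<noteq> {\<one>}" by auto
    have "card H \<noteq> order G" using cH order_small P3 by linarith
    then show "H \<noteq> carrier G" unfolding order_def by metis
    fix K assume K: "K \<in> conjugates P \<union> orbit_T"
    show "H <#> K \<noteq> carrier G"
    proof (cases "H \<in> conjugates P \<and> K \<in> conjugates P")
      case True
      then obtain g h where "g \<in> carrier G" "H = conjugate g P" "h \<in> carrier G" "K = conjugate h P"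
        by (auto simp: conjugates_def)
      then show ?thesis using conjugate_mult_conjugate_neq_carrier[OF sP PG, of g h] by simp
    next
      case False
      have cK: "subgroup K G \<and> (card K = card P \<or> card K = 2)" using K conjP[of K] orbit_T[of K] by blast
      have "card H = 2 \<or> card K = 2" using False H K orbit_T[of H] orbit_T[of K] by blast
      then have "card H * card K \<le> 2 * card P" using cH cK P3 by auto
      then have "card H * card K < order G" using order_small P3 by linarith
      then show ?thesis using small[of H K] cH cK by simp
    qed
  qed
  moreover have "conjugates P \<inter> orbit_T = {}"
  proof -
    have "\<forall>H\<in>conjugates P. card H = card P" "\<forall>H\<in>orbit_T. card H = 2" using conjP orbit_T by simp_all
    then show ?thesis using P3 by auto
  qed
  ultimately show False using card_orbit n4 finite_orbit by (simp add: card_Un_disjoint n_def)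
qed

end

section \<open>A self-normalizing Sylow 2-subgroup acting on a normal subgroup of order 3 or 5\<close>

text \<open>The situation that remains for a non-nilpotent group: \<open>G\<close> is the product of its normal subgroup \<open>Q\<close>
and the Sylow 2-subgroup \<open>P\<close>.\<close>

locale self_normalizing_sylow_2 = small_independence_group +
  fixes P Q :: "'a set" and n k :: nat
  assumes n_cases: "n = 3 \<or> n = 5"
    and subgroup_P: "subgroup P G" and card_P: "card P = 2 ^ k"
    and normal_Q: "Q \<lhd> G" and card_Q: "card Q = n"
    and order_G: "order G = n * 2 ^ k"
    and normalizer_P: "normalizer G P = P"
    and card_conjugates_P: "card (conjugates P) = n"
begin

lemma prime_n: "prime n"
proof -
  have "prime (3::nat)" "prime (5::nat)" by simp_all
  then show ?thesis using n_cases by auto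
qed

lemma subgroup_Q: "subgroup Q G"
  using normal_Q by (rule normal_imp_subgroup)

lemma P_carrier: "x \<in> P \<Longrightarrow> x \<in> carrier G"
  using subgroup_P by (rule subgroup.mem_carrier)

lemma Q_carrier: "x \<in> Q \<Longrightarrow> x \<in> carrier G"
  using subgroup_Q by (rule subgroup.mem_carrier)

lemma P_Int_Q: "x \<in> P \<Longrightarrow> x \<in> Q \<Longrightarrow> x = \<one>"
proof -
  have "coprime (card P) (card Q)"
    using n_cases unfolding card_P card_Q by (elim disjE) simp_all
  then show "x \<in> P \<Longrightarrow> x \<in> Q \<Longrightarrow> x = \<one>"
    by (rule eq_one_of_mem_coprime_subgroups[OF subgroup_P subgroup_Q])
qed

lemma ord_Q:
  assumes "g \<in> Q" "g \<noteq> \<one>"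
  shows "ord g = n"
proof -
  have "ord g dvd n" using ord_dvd_card_subgroup[OF subgroup_Q assms(1)] by (simp add: card_Q)
  moreover have "ord g \<noteq> 1" using assms ord_eq_1[OF Q_carrier[OF assms(1)]] by simp
  ultimately show ?thesis using prime_n by (auto simp: prime_nat_iff)
qed

lemma generate_Q:
  assumes "g \<in> Q" "g \<noteq> \<one>"
  shows "generate G {g} = Q"
proof (rule card_subset_eq)
  show "finite Q" using subgroup_Q by (rule finite_subgroup)
  show "generate G {g} \<subseteq> Q" using assms(1) by (intro generate_subgroup_incl subgroup_Q) simp
  show "card (generate G {g}) = card Q"
    using generate_pow_card[OF Q_carrier[OF assms(1)]] ord_Q[OF assms] card_Q by simp
qed

lemma commute_Q:
  assumes x: "x \<in> carrier G" and g: "g \<in> Q" "g \<noteq> \<one>" "x \<otimes> g = g \<otimes> x" and y: "y \<in> Q"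
  shows "x \<otimes> y = y \<otimes> x"
proof -
  have "generate G {g} \<subseteq> {g \<in> carrier G. commute_mod {\<one>} x g}"
    using g x Q_carrier
    by (intro generate_subgroup_incl subgroup_commute_mod one_is_normal) (simp_all add: commute_iff_commute_mod)
  then have "commute_mod {\<one>} x y" using generate_Q[OF g(1,2)] y by auto
  then show ?thesis using x Q_carrier[OF y] by (simp add: commute_iff_commute_mod)
qed

text \<open>An element \<open>g\<close> of \<open>Q\<close> that normalizes \<open>H\<close> has \<open>[g, h] \<in> P \<inter> Q\<close>, so \<open>g\<close> commutes with \<open>h\<close>. As \<open>Q\<close> has
prime order and \<open>h\<close> does not centralize it, \<open>g\<close> is trivial.\<close>

lemma card_Q_conjugates:
  assumes H: "subgroup H G" "H \<subseteq> P" and h: "h \<in> H" "q \<in> Q" "h \<otimes> q \<noteq> q \<otimes> h"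
  shows "card ((\<lambda>g. conjugate g H) ` Q) = n"
proof -
  have hc: "h \<in> carrier G" using H(1) h(1) by (rule subgroup.mem_carrier)
  have "{g \<in> Q. conjugate g H = H} = {\<one>}"
  proof (intro subset_antisym subsetI)
    fix g assume "g \<in> {g \<in> Q. conjugate g H = H}"
    then have g: "g \<in> Q" "conjugate g H = H" by auto
    have gc: "g \<in> carrier G" using g(1) by (rule Q_carrier)
    have "g \<otimes> h \<otimes> inv g \<in> H" using g(2) h(1) by (auto simp: conjugate_def)
    then have "(g \<otimes> h \<otimes> inv g) \<otimes> inv h \<in> H"
      using subgroup.m_inv_closed[OF H(1) h(1)] by (rule subgroup.m_closed[OF H(1)])
    then have inP: "g \<otimes> h \<otimes> inv g \<otimes> inv h \<in> P" using H(2) by blast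
    have "h \<otimes> inv g \<otimes> inv h \<in> Q"
      using normal.inv_op_closed2[OF normal_Q hc] subgroup.m_inv_closed[OF subgroup_Q g(1)] by blast
    then have "g \<otimes> (h \<otimes> inv g \<otimes> inv h) \<in> Q" by (rule subgroup.m_closed[OF subgroup_Q g(1)])
    then have "g \<otimes> h \<otimes> inv g \<otimes> inv h \<in> Q" using gc hc by (simp add: m_assoc)
    then have "commute_mod {\<one>} g h" using P_Int_Q[OF inP] by (simp add: commute_mod_def)
    then have "h \<otimes> g = g \<otimes> h" using gc hc by (simp add: commute_iff_commute_mod)
    then show "g \<in> {\<one>}" using commute_Q[OF hc g(1) _ _ h(2)] h(3) by blast
  next
    fix g assume "g \<in> {\<one>}"
    then show "g \<in> {g \<in> Q. conjugate g H = H}"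
      using subgroup.one_closed[OF subgroup_Q] conjugate_one[OF subgroup.subset[OF H(1)]] by simp
  qed
  then show ?thesis
    using conjugates_orbit_stabilizer[OF subgroup_Q subgroup.subset[OF H(1)]] card_Q by simp
qed

lemma P_neq_carrier: "P \<noteq> carrier G"
proof
  assume "P = carrier G"
  then have "2 ^ k = n * 2 ^ k" using card_P order_G by (simp add: order_def)
  then show False using n_cases by auto
qed

text \<open>The counting principle for \<open>P\<close>, with the \<open>n\<close> conjugates of \<open>P\<close> already entered: it bounds any
collection of smaller subgroups of \<open>P\<close> and of conjugates of such subgroups.\<close>

lemma card_subgroups_below_P:
  assumes "\<And>H. H \<in> F \<Longrightarrow> subgroup H G \<and> H \<noteq> {\<one>} \<and> H \<noteq> P \<and> H \<subseteq> P"
    and conj: "\<And>H. H \<in> F' \<Longrightarrow> \<exists>g\<in>carrier G. \<exists>K\<in>F. H = conjugate g K"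
  shows "n + card (F \<union> F') \<le> 6"
proof -
  have P1: "P \<noteq> {\<one>}"
  proof
    assume "P = {\<one>}"
    then have "P \<lhd> G" using one_is_normal by simp
    then have "n = 1"
      using card_conjugates_eq_1_iff[OF subgroup_P finite_carrier] card_conjugates_P by simp
    then show False using n_cases by auto
  qed
  have Pc: "P \<subseteq> carrier G" using subgroup_P by (rule subgroup.subset)
  have F: "subgroup H G \<and> H \<noteq> {\<one>} \<and> card H \<noteq> card P \<and> (\<exists>g\<in>carrier G. H \<subseteq> conjugate g P)"
    if H: "H \<in> F \<union> F'" for H
  proof -
    obtain g K where K: "g \<in> carrier G" "K \<in> F" "H = conjugate g K"
    proof (cases "H \<in> F")
      case True
      then have "H = conjugate \<one> H" using assms(1) subgroup.subset conjugate_one by metis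
      then show ?thesis using that True one_closed by blast
    next
      case False
      then show ?thesis using H conj that by blast
    qed
    have sK: "subgroup K G" "K \<noteq> {\<one>}" "K \<noteq> P" "K \<subseteq> P" using assms(1)[OF K(2)] by auto
    have "card K \<noteq> card P" using sK(3,4) card_subset_eq[OF finite_subgroup[OF subgroup_P]] by blast
    moreover have "card H = card K" using K(1,3) card_conjugate[OF _ subgroup.subset[OF sK(1)]] by simp
    ultimately show ?thesis
      using subgroup_conjugate[OF K(1) sK(1)] conjugate_neq_one[OF sK(1,2) K(1)]
        conjugate_mono[OF sK(4), of g] K(1,3) by auto
  qed
  have P: "subgroup H G \<and> H \<noteq> {\<one>} \<and> card H = card P \<and> (\<exists>g\<in>carrier G. H \<subseteq> conjugate g P)"
    if "H \<in> conjugates P" for H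
  proof -
    obtain g where g: "g \<in> carrier G" "H = conjugate g P"
      using \<open>H \<in> conjugates P\<close> by (auto simp: conjugates_def)
    show ?thesis
      unfolding g(2) using conjugate_neq_one[OF subgroup_P P1 g(1)]
        subgroup_conjugate[OF g(1) subgroup_P] card_conjugate[OF g(1) Pc] g(1) by blast
  qed
  let ?U = "conjugates P \<union> (F \<union> F')"
  have all: "subgroup H G \<and> H \<noteq> {\<one>} \<and> (\<exists>g\<in>carrier G. H \<subseteq> conjugate g P)" if "H \<in> ?U" for H
    using that F[of H] P[of H] by blast
  have "finite ?U"
    by (rule card_subgroups_below_conjugates(1)[OF subgroup_P P_neq_carrier]) (use all in simp_all)
  moreover have "card ?U \<le> 6"
    by (rule card_subgroups_below_conjugates(2)[OF subgroup_P P_neq_carrier]) (use all in simp_all)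
  moreover have "conjugates P \<inter> (F \<union> F') = {}" using F P by blast
  ultimately show ?thesis using card_conjugates_P by (simp add: card_Un_disjoint)
qed

text \<open>Otherwise \<open>H\<close> contributes \<open>n\<close> conjugates to the count, which leaves only \<open>n = 3\<close>. The
centralizer \<open>C\<close> of \<open>Q\<close> in \<open>P\<close> would be one subgroup more, so it is trivial and every nontrivial
element of \<open>P\<close> inverts \<open>Q\<close>. The product of two such elements centralizes \<open>Q\<close>, hence is 1, so
\<open>P\<close> cannot be larger than \<open>H\<close>.\<close>

lemma commute_of_mem_proper_subgroup:
  assumes H: "subgroup H G" "H \<subseteq> P" "H \<noteq> P" and h: "h \<in> H" and q: "q \<in> Q"
  shows "h \<otimes> q = q \<otimes> h"
proof (rule ccontr)
  assume nc: "h \<otimes> q \<noteq> q \<otimes> h"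
  have hc: "h \<in> carrier G" using H(1) h by (rule subgroup.mem_carrier)
  have qc: "q \<in> carrier G" using q by (rule Q_carrier)
  have Hc: "H \<subseteq> carrier G" using H(1) by (rule subgroup.subset)
  have h1: "h \<noteq> \<one>" and q1: "q \<noteq> \<one>" using nc hc qc by auto
  define F' where "F' = (\<lambda>g. conjugate g H) ` Q"
  have cardF': "card F' = n" unfolding F'_def using H(1,2) h q nc by (rule card_Q_conjugates)
  have HF': "H \<in> F'"
    unfolding F'_def using conjugate_one[OF Hc] subgroup.one_closed[OF subgroup_Q] by (metis imageI)
  have H1: "H \<noteq> {\<one>}" using h h1 by auto
  define C where "C = P \<inter> {x \<in> carrier G. commute_mod {\<one>} q x}"
  have sC: "subgroup C G"
    unfolding C_def using subgroup_commute_mod[OF one_is_normal qc] subgroup_P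
    by (intro subgroups_Inter_pair)
  have C_iff: "x \<in> C \<longleftrightarrow> x \<in> P \<and> x \<otimes> q = q \<otimes> x" for x
    using P_carrier[of x] qc by (auto simp: C_def commute_iff_commute_mod)
  have hC: "h \<notin> C" using nc by (simp add: C_iff)
  have hP: "h \<in> P" using h H(2) by blast
  have F'_cond: "\<exists>g\<in>carrier G. \<exists>K\<in>F. A = conjugate g K" if "A \<in> F'" "H \<in> F" for A F
    using that Q_carrier by (auto simp: F'_def)
  have "n + card ({H} \<union> F') \<le> 6"
    by (rule card_subgroups_below_P) (use H H1 F'_cond[of _ "{H}"] in auto)
  then have n3: "n = 3" using HF' cardF' n_cases by (simp add: insert_absorb)
  have C1: "C = {\<one>}"
  proof (rule ccontr)
    assume "C \<noteq> {\<one>}"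
    then have "n + card ({H, C} \<union> F') \<le> 6"
      using H H1 sC hC hP by (intro card_subgroups_below_P) (use F'_cond[of _ "{H, C}"] in \<open>auto simp: C_iff\<close>)
    moreover have "C \<notin> F'"
    proof
      assume "C \<in> F'"
      then obtain g where g: "g \<in> Q" "C = conjugate g H" by (auto simp: F'_def)
      have gc: "g \<in> carrier G" using g(1) by (rule Q_carrier)
      have "inv g \<otimes> x \<otimes> inv (inv g) = x" if x: "x \<in> C" for x
      proof -
        have xc: "x \<in> carrier G" using x P_carrier by (simp add: C_iff)
        have "x \<otimes> g = g \<otimes> x" using commute_Q[OF xc q q1 _ g(1)] x by (simp add: C_iff)
        then show ?thesis using gc xc by (simp add: m_assoc mult_inv_cancel_left)
      qed
      then have "conjugate (inv g) C = C" by (simp add: conjugate_def)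
      then have "C = H" using g(2) conjugate_inv_cancel[OF gc Hc] by simp
      then show False using h hC by simp
    qed
    moreover have "finite F'" using finite_subgroup[OF subgroup_Q] by (simp add: F'_def)
    ultimately show False using HF' cardF' n3 by (simp add: insert_absorb insert_commute)
  qed
  have q_ne: "q \<noteq> inv q"
  proof
    assume "q = inv q"
    then have "q \<otimes> q = \<one>" using qc r_inv[OF qc] by simp
    then have "q [^] (2::nat) = \<one>" using qc by (simp add: numeral_2_eq_2)
    then have "ord q dvd 2" using qc pow_eq_id by blast
    then show False using ord_Q[OF q q1] n3 by simp
  qed
  have Q_eq: "Q = {\<one>, q, inv q}"
  proof -
    have "inv q \<noteq> \<one>" using q1 qc by (metis inv_inv inv_one)
    then have "card {\<one>, q, inv q} = card Q" using q1 q_ne card_Q n3 by auto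
    moreover have "{\<one>, q, inv q} \<subseteq> Q"
      using q subgroup.one_closed[OF subgroup_Q] subgroup.m_inv_closed[OF subgroup_Q q] by blast
    ultimately show ?thesis using card_subset_eq[OF finite_subgroup[OF subgroup_Q]] by metis
  qed
  have inverts: "y \<otimes> q \<otimes> inv y = inv q" if y: "y \<in> P" "y \<noteq> \<one>" for y
  proof -
    have yc: "y \<in> carrier G" using y(1) by (rule P_carrier)
    have "y \<otimes> q \<otimes> inv y \<in> Q" using normal.inv_op_closed2[OF normal_Q yc q] .
    moreover have "y \<otimes> q \<otimes> inv y \<noteq> q"
    proof
      assume "y \<otimes> q \<otimes> inv y = q"
      then have "y \<otimes> q \<otimes> inv y \<otimes> y = q \<otimes> y" by simp
      then have "y \<otimes> q = q \<otimes> y" using yc qc by (simp add: m_assoc)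
      then have "y \<in> C" using y(1) by (simp add: C_iff)
      then show False using C1 y(2) by simp
    qed
    moreover have "y \<otimes> q \<otimes> inv y \<noteq> \<one>"
    proof
      assume *: "y \<otimes> q \<otimes> inv y = \<one>"
      have "inv y \<otimes> (y \<otimes> q \<otimes> inv y) \<otimes> y = q" using yc qc by (simp add: m_assoc mult_inv_cancel_left)
      then show False using * yc q1 by simp
    qed
    ultimately show ?thesis using Q_eq by blast
  qed
  have "P \<subseteq> H"
  proof
    fix y assume y: "y \<in> P"
    show "y \<in> H"
    proof (cases "y = \<one>")
      case True
      then show ?thesis using subgroup.one_closed[OF H(1)] by simp
    next
      case False
      have yc: "y \<in> carrier G" using y by (rule P_carrier)
      have "(y \<otimes> h) \<otimes> q \<otimes> inv (y \<otimes> h) = y \<otimes> (h \<otimes> q \<otimes> inv h) \<otimes> inv y"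
        using yc hc qc by (simp add: inv_mult_group m_assoc)
      also have "\<dots> = y \<otimes> inv q \<otimes> inv y" by (simp add: inverts[OF hP h1])
      also have "\<dots> = inv (y \<otimes> q \<otimes> inv y)" using yc qc by (simp add: inv_mult_group m_assoc)
      also have "\<dots> = q" using qc by (simp add: inverts[OF y False])
      finally have "(y \<otimes> h) \<otimes> q \<otimes> inv (y \<otimes> h) \<otimes> (y \<otimes> h) = q \<otimes> (y \<otimes> h)" by simp
      then have "(y \<otimes> h) \<otimes> q = q \<otimes> (y \<otimes> h)" using yc hc qc by (simp add: m_assoc inv_mult_group mult_inv_cancel_left)
      moreover have "y \<otimes> h \<in> P" using subgroup.m_closed[OF subgroup_P y hP] .
      ultimately have "y \<otimes> h = \<one>" using C_iff[of "y \<otimes> h"] C1 by simp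
      then have "y = inv h" using yc hc inv_equality by metis
      then show ?thesis using subgroup.m_inv_closed[OF H(1) h] by simp
    qed
  qed
  then show False using H(2,3) by simp
qed

end

section \<open>Determination of the group\<close>

context self_normalizing_sylow_2
begin

text \<open>Otherwise \<open>Q\<close> would normalize \<open>P\<close> and hence be contained in \<open>P\<close>.\<close>

lemma ex_not_commuting: "\<exists>x\<in>P. \<exists>q\<in>Q. x \<otimes> q \<noteq> q \<otimes> x"
proof (rule ccontr)
  assume "\<not> ?thesis"
  then have comm: "\<And>x q. x \<in> P \<Longrightarrow> q \<in> Q \<Longrightarrow> x \<otimes> q = q \<otimes> x" by blast
  have "Q \<subseteq> P"
  proof
    fix q assume q: "q \<in> Q"
    have qc: "q \<in> carrier G" using q by (rule Q_carrier)
    have "q \<otimes> x \<otimes> inv q = x" if x: "x \<in> P" for x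
      using comm[OF x q, symmetric] P_carrier[OF x] qc by (simp add: m_assoc)
    then have "conjugate q P = P" by (simp add: conjugate_def)
    then show "q \<in> P"
      using normalizer_P normalizer_eq[OF subgroup.subset[OF subgroup_P]] qc by blast
  qed
  then have "Q \<subseteq> {\<one>}" using P_Int_Q by blast
  then have "card Q \<le> 1" using card_mono[of "{\<one>}" Q] by simp
  then show False using card_Q n_cases by auto
qed

lemma k_positive: "0 < k"
proof (rule ccontr)
  assume "\<not> 0 < k"
  then have "card P = 1" by (simp add: card_P)
  then have P1: "P = {\<one>}" using subgroup_neq_one_iff_card[OF subgroup_P] by blast
  obtain x q where "x \<in> P" "q \<in> Q" "x \<otimes> q \<noteq> q \<otimes> x" using ex_not_commuting by blast
  then show False using P1 Q_carrier[of q] by simp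
qed

text \<open>An element \<open>x\<close> of \<open>P\<close> that does not commute with \<open>q\<close> generates no proper subgroup of \<open>P\<close>. Its
square does, so the square commutes with \<open>q\<close>. Put \<open>v = x q x\<inverse>\<close>. Conjugation by \<open>x\<close> exchanges \<open>q\<close> and
\<open>v\<close>, so \<open>x\<close> commutes with \<open>q v\<close>; since \<open>x\<close> does not centralize \<open>Q\<close>, this element is trivial.\<close>

lemma ex_inverting_generator:
  "\<exists>x\<in>P. \<exists>q\<in>Q. generate G {x} = P \<and> ord x = 2 ^ k \<and> ord q = n \<and> x \<otimes> q \<otimes> inv x = inv q"
proof -
  obtain x q where x: "x \<in> P" and q: "q \<in> Q" and nc: "x \<otimes> q \<noteq> q \<otimes> x"
    using ex_not_commuting by blast
  have xc: "x \<in> carrier G" using x by (rule P_carrier)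
  have qc: "q \<in> carrier G" using q by (rule Q_carrier)
  have q1: "q \<noteq> \<one>" using nc xc by auto
  have gen_sub: "subgroup (generate G {y}) G \<and> generate G {y} \<subseteq> P \<and> y \<in> generate G {y}" if "y \<in> P" for y
  proof (intro conjI)
    show "subgroup (generate G {y}) G" using P_carrier[OF that] by (intro generate_is_subgroup) simp
    show "generate G {y} \<subseteq> P" using that by (intro generate_subgroup_incl subgroup_P) simp
    show "y \<in> generate G {y}" by (rule generate.incl) simp
  qed
  have gen_P: "generate G {y} = P" if y: "y \<in> P" "y \<otimes> q \<noteq> q \<otimes> y" for y
  proof (rule ccontr)
    assume "generate G {y} \<noteq> P"
    then have "y \<otimes> q = q \<otimes> y"
      using gen_sub[OF y(1)] q by (intro commute_of_mem_proper_subgroup[of "generate G {y}"]) simp_all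
    then show False using y(2) by contradiction
  qed
  have gx: "generate G {x} = P" using gen_P[OF x nc] .
  have ox: "ord x = 2 ^ k" using generate_pow_card[OF xc] gx card_P by simp
  have xx: "x \<otimes> x \<in> P" using subgroup.m_closed[OF subgroup_P x x] .
  have sq: "(x \<otimes> x) \<otimes> q = q \<otimes> (x \<otimes> x)"
  proof (rule ccontr)
    assume "(x \<otimes> x) \<otimes> q \<noteq> q \<otimes> (x \<otimes> x)"
    then have "generate G {x \<otimes> x} = P" by (rule gen_P[OF xx])
    then have "ord (x \<otimes> x) = 2 ^ k" using generate_pow_card[OF P_carrier[OF xx]] card_P by simp
    moreover have "x \<otimes> x = x [^] (2::nat)" using xc by (simp add: numeral_2_eq_2)
    moreover have "ord (x [^] (2::nat)) = 2 ^ k div 2" using ord_pow[OF xc, of 2] ox k_positive by simp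
    ultimately have "(2::nat) ^ k = 2 ^ k div 2" by simp
    moreover have "(2::nat) ^ k > 0" by simp
    ultimately show False by linarith
  qed
  define v where "v = x \<otimes> q \<otimes> inv x"
  have vQ: "v \<in> Q" unfolding v_def using normal.inv_op_closed2[OF normal_Q xc q] .
  have vc: "v \<in> carrier G" using vQ by (rule Q_carrier)
  have "x \<otimes> (q \<otimes> v) = (q \<otimes> v) \<otimes> x"
  proof -
    have "x \<otimes> v = (x \<otimes> x) \<otimes> q \<otimes> inv x" using xc qc by (simp add: v_def m_assoc)
    also have "\<dots> = q \<otimes> x" unfolding sq using xc qc by (simp add: m_assoc)
    finally have xv: "x \<otimes> v = q \<otimes> x" .
    have xq: "x \<otimes> q = v \<otimes> x" using xc qc by (simp add: v_def m_assoc)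
    have "q \<otimes> v = v \<otimes> q" using commute_Q[OF qc q q1 refl vQ] .
    then have "x \<otimes> (q \<otimes> v) = (x \<otimes> v) \<otimes> q" using xc qc vc by (simp add: m_assoc)
    also have "\<dots> = q \<otimes> (x \<otimes> q)" unfolding xv using xc qc by (simp add: m_assoc)
    also have "\<dots> = (q \<otimes> v) \<otimes> x" using xc qc vc by (simp add: xq m_assoc)
    finally show ?thesis .
  qed
  moreover have "q \<otimes> v \<in> Q" using subgroup.m_closed[OF subgroup_Q q vQ] .
  ultimately have "q \<otimes> v = \<one>" using commute_Q[OF xc _ _ _ q, of "q \<otimes> v"] nc by metis
  then have "v = inv q" using mult_inv_cancel_left(1)[OF qc vc] qc by simp
  then have "x \<otimes> q \<otimes> inv x = inv q" by (simp only: v_def)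
  then show ?thesis using x q gx ox ord_Q[OF q q1] by blast
qed

lemma ex_subgroup_of_P:
  assumes "i \<le> k"
  shows "\<exists>C. subgroup C G \<and> C \<subseteq> P \<and> card C = 2 ^ i"
  using ex_subgroup_prime_power_card[OF two_is_prime_nat finite_carrier subgroup_P, of i] assms
  by (simp add: card_P le_imp_power_dvd)

text \<open>Otherwise \<open>P\<close> has proper subgroups of order 2 and 4, which together with the five conjugates of \<open>P\<close>
are seven subgroups.\<close>

lemma k_le_2_if_n_5:
  assumes "n = 5"
  shows "k \<le> 2"
proof (rule ccontr)
  assume "\<not> k \<le> 2"
  then have k3: "3 \<le> k" by simp
  obtain A where A: "subgroup A G" "A \<subseteq> P" "card A = 2 ^ 1" using ex_subgroup_of_P[of 1] k3 by auto
  obtain B where B: "subgroup B G" "B \<subseteq> P" "card B = 2 ^ 2" using ex_subgroup_of_P[of 2] k3 by auto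
  have "(2::nat) ^ 3 \<le> 2 ^ k" using k3 by (rule power_increasing) simp
  then have "8 \<le> card P" by (simp add: card_P)
  then have "n + card ({A, B} \<union> {}) \<le> 6"
    using A B by (intro card_subgroups_below_P) auto
  moreover have "A \<noteq> B" using A(3) B(3) by auto
  ultimately show False using assms by simp
qed

text \<open>If \<open>k \<ge> 4\<close>, the proper subgroup \<open>Q C\<close>, where \<open>C\<close> has index 2 in \<open>P\<close>, has subgroups of the seven
orders 2, 4, 8, 3, 6, 12, 24.\<close>

lemma k_le_3_if_n_3:
  assumes n3: "n = 3"
  shows "k \<le> 3"
proof (rule ccontr)
  assume "\<not> k \<le> 3"
  then have k4: "4 \<le> k" by simp
  obtain C where C: "subgroup C G" "C \<subseteq> P" "card C = 2 ^ (k - 1)"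
    using ex_subgroup_of_P[of "k - 1"] by auto
  define M where "M = Q <#> C"
  have sQD: "subgroup (Q <#> D) G \<and> Q \<subseteq> Q <#> D \<and> D \<subseteq> Q <#> D" if D: "subgroup D G" for D
  proof (intro conjI)
    show "subgroup (Q <#> D) G" using normal_Q D by (rule mult_norm_subgroup)
    show "Q \<subseteq> Q <#> D"
      using subgroup.one_closed[OF D] Q_carrier by (force simp: set_mult_def)
    show "D \<subseteq> Q <#> D"
      using subgroup.one_closed[OF subgroup_Q] subgroup.mem_carrier[OF D] by (force simp: set_mult_def)
  qed
  have sM: "subgroup M G" unfolding M_def using sQD[OF C(1)] by blast
  have "card M \<le> n * 2 ^ (k - 1)"
    unfolding M_def using card_set_mult_le[of Q C] finite_subgroup subgroup_Q C card_Q by simp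
  also have "\<dots> < order G" using order_G k4 n3 by simp
  finally have MG: "M \<noteq> carrier G" by (auto simp: order_def)
  define F where "F = {H. subgroup H G \<and> H \<noteq> {\<one>} \<and> H \<subseteq> M}"
  have M1: "conjugate \<one> M = M" using conjugate_one[OF subgroup.subset[OF sM]] .
  have F: "H \<in> F \<Longrightarrow> subgroup H G" "H \<in> F \<Longrightarrow> H \<noteq> {\<one>}" for H
    by (simp_all add: F_def)
  have FM: "\<exists>g\<in>carrier G. H \<subseteq> conjugate g M" if "H \<in> F" for H
  proof (rule bexI[OF _ one_closed])
    show "H \<subseteq> conjugate \<one> M" using that M1 by (simp add: F_def)
  qed
  have cards: "2 ^ i \<in> card ` F \<and> 3 * 2 ^ i \<in> card ` F" if i: "0 < i" "i < k" for i
  proof -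
    have "2 ^ i dvd card C" using i by (simp add: C(3) le_imp_power_dvd)
    from ex_subgroup_prime_power_card[OF two_is_prime_nat finite_carrier C(1) this]
    obtain D where D: "subgroup D G" "D \<subseteq> C" "card D = 2 ^ i" by auto
    have sub: "Q <#> D \<subseteq> M" unfolding M_def using D(2) by (intro mono_set_mult) auto
    have "card D dvd card (Q <#> D)" "card Q dvd card (Q <#> D)"
      using sQD[OF D(1)] card_subgroup_dvd D(1) subgroup_Q by simp_all
    moreover have "coprime (card D) (card Q)" using D(3) card_Q n3 by simp
    ultimately have "card D * card Q dvd card (Q <#> D)" by (rule divides_mult)
    then have "card D * card Q \<le> card (Q <#> D)"
      using sQD[OF D(1)] subgroup.finite_imp_card_positive[OF _ finite_carrier] by (intro dvd_imp_le) simp_all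
    moreover have "card (Q <#> D) \<le> card Q * card D"
      using card_set_mult_le[of Q D] finite_subgroup subgroup_Q D(1) by simp
    ultimately have cQD: "card (Q <#> D) = 3 * 2 ^ i" using card_Q n3 D(3) by simp
    have "(1::nat) < 2 ^ i" using i(1) by (intro one_less_power) simp_all
    then have gt1: "1 < card D" "1 < card (Q <#> D)" unfolding D(3) cQD by simp_all
    have "D \<noteq> {\<one>}" using gt1(1) by auto
    moreover have "D \<subseteq> M" using sub sQD[OF D(1)] by blast
    ultimately have "D \<in> F" using D(1) by (simp add: F_def)
    moreover have "Q <#> D \<noteq> {\<one>}" using gt1(2) by auto
    then have "Q <#> D \<in> F" using sQD[OF D(1)] sub by (simp add: F_def)
    ultimately show ?thesis using D(3) cQD by (metis imageI)
  qed
  have "Q \<noteq> {\<one>}" using card_Q n3 by auto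
  then have "Q \<in> F" using subgroup_Q sQD[OF C(1)] by (simp add: F_def M_def)
  then have "3 \<in> card ` F" using card_Q n3 by (metis imageI)
  then have "{3, 2, 4, 8, 6, 12, 24} \<subseteq> card ` F"
    using cards[of 1] cards[of 2] cards[of 3] k4 by simp
  moreover have finF: "finite F" by (rule card_subgroups_below_conjugates(1)[OF sM MG F FM])
  ultimately have "card {3, 2, 4, 8, 6, 12, 24 :: nat} \<le> card (card ` F)" by (intro card_mono) simp_all
  also have "\<dots> \<le> card F" using finF by (rule card_image_le)
  also have "\<dots> \<le> 6" by (rule card_subgroups_below_conjugates(2)[OF sM MG F FM])
  finally show False by simp
qed

lemma iso_inversion_semidirect_n_k: "G \<cong> inversion_semidirect n (2 ^ k)"
proof -
  obtain x q where x: "x \<in> P" "ord x = 2 ^ k" and q: "q \<in> Q" "ord q = n"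
    and inv: "x \<otimes> q \<otimes> inv x = inv q"
    using ex_inverting_generator by blast
  have "coprime n (2 ^ k)" using n_cases by (elim disjE) simp_all
  then show ?thesis
    using n_cases k_positive
    by (intro iso_inversion_semidirect[OF Q_carrier[OF q(1)] q(2) P_carrier[OF x(1)] x(2) inv order_G]) auto
qed

lemma iso_inversion_semidirect_cases:
  "G \<cong> inversion_semidirect 3 2 \<or> G \<cong> inversion_semidirect 5 2 \<or> G \<cong> inversion_semidirect 3 4
    \<or> G \<cong> inversion_semidirect 3 8 \<or> G \<cong> inversion_semidirect 5 4"
proof (cases "n = 3")
  case True
  then have "k = 1 \<or> k = 2 \<or> k = 3" using k_positive k_le_3_if_n_3 by linarith
  then show ?thesis using iso_inversion_semidirect_n_k True by auto
next
  case False
  then have "n = 5" using n_cases by simp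
  moreover have "k = 1 \<or> k = 2" using k_positive k_le_2_if_n_5[OF \<open>n = 5\<close>] by linarith
  ultimately show ?thesis using iso_inversion_semidirect_n_k by auto
qed

end

lemma (in small_independence_group) ex_self_normalizing_sylow_2:
  assumes "\<not> nilpotent_group G"
  shows "\<exists>P Q n k. self_normalizing_sylow_2 G P Q n k"
proof -
  obtain p P where p: "prime p" and P: "sylow_subgroup p P" and nn: "\<not> P \<lhd> G"
    using nilpotent_of_normal_sylow[OF finite_carrier] assms by blast
  \<comment> \<open>With \<open>p = 2\<close> the number of conjugates is odd and between 3 and 6, hence 3 or 5.\<close>
  have "\<not> odd p" using odd_sylow_normal[OF p _ P] nn by blast
  then have p2: "p = 2" using p primes_dvd_imp_eq[of 2 p] by simp
  define n where "n = card (conjugates P)"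
  define k where "k = multiplicity p (order G)"
  have sP: "subgroup P G" and cardP: "card P = 2 ^ k" using P p2 by (auto simp: sylow_subgroup_def k_def)
  note facts = non_normal_sylow[OF p P nn]
  have order: "order G = n * 2 ^ k"
    unfolding n_def cardP[symmetric] using p P nn by (rule order_eq_conjugates_times_sylow)
  have "p dvd n - 1" unfolding n_def using p finite_carrier P by (rule sylow_card_conjugates_mod)
  then have n: "n = 3 \<or> n = 5" using facts(1,2) p2 unfolding n_def[symmetric] by presburger
  have pn: "prime n"
  proof -
    have "prime (3::nat)" "prime (5::nat)" by simp_all
    then show ?thesis using n by auto
  qed
  obtain Q where Q: "sylow_subgroup n Q" using ex_sylow_subgroup[OF pn finite_carrier] by blast
  have "multiplicity n (order G) = 1"
  proof -
    have "\<not> n dvd 2 ^ k"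
    proof
      assume "n dvd 2 ^ k"
      then have "n dvd 2" using pn prime_dvd_power_nat by blast
      then show False using n by auto
    qed
    then show ?thesis
      using pn n by (simp add: order prime_elem_multiplicity_mult_distrib not_dvd_imp_multiplicity_0)
  qed
  then have cardQ: "card Q = n" using Q by (simp add: sylow_subgroup_def)
  have "odd n" using n by auto
  then have "Q \<lhd> G" using odd_sylow_normal[OF pn _ Q] by simp
  then have "self_normalizing_sylow_2 G P Q n k"
    using n sP cardP cardQ order facts(3)
    by (intro self_normalizing_sylow_2.intro small_independence_group_axioms
        self_normalizing_sylow_2_axioms.intro) (simp_all add: n_def)
  then show ?thesis by blast
qed

theorem theorem4p1:
  fixes G :: "('a, 'b) monoid_scheme"
  assumes "group G"
    and "finite (carrier G)"
    and "independence_number (comaximal_subgroup_graph G) \<le> 6"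
  shows "nilpotent_group G
    \<or> G \<cong> sym_group 3
    \<or> G \<cong> dihedral_group 5
    \<or> G \<cong> inversion_semidirect 3 4
    \<or> G \<cong> inversion_semidirect 3 8
    \<or> G \<cong> inversion_semidirect 5 4"
proof (cases "nilpotent_group G")
  case False
  interpret small_independence_group G
    using assms by (simp add: small_independence_group_def small_independence_group_axioms_def)
  obtain P Q n k where "self_normalizing_sylow_2 G P Q n k"
    using ex_self_normalizing_sylow_2[OF False] by blast
  then have "G \<cong> inversion_semidirect 3 2 \<or> G \<cong> inversion_semidirect 5 2 \<or> G \<cong> inversion_semidirect 3 4
      \<or> G \<cong> inversion_semidirect 3 8 \<or> G \<cong> inversion_semidirect 5 4"
    by (rule self_normalizing_sylow_2.iso_inversion_semidirect_cases)
  moreover have "G \<cong> sym_group 3" if "G \<cong> inversion_semidirect 3 2"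
    using that group.iso_sym[OF sym_group_is_group sym_group_3_iso_inversion_semidirect]
    by (rule iso_trans)
  ultimately show ?thesis unfolding dihedral_group_def by blast
qed simp

end
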